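(* Let $\tilde M\in\mathbb R^{m\times n}$ have rank $r$, let $M=\tilde M+E$, let $H\in\mathbb R^{n\times l}$ be a multiplier of full numerical rank $l$, $r\le l\le n$, and let $U,V$ be the matrices output by the range finder algorithm described in the context (version with the QR factor) applied to $M$, $r$, $H$. (i) Then $$\|M-UV\|\le 2\|E\|+\Big(\|EH\|+\sqrt2\,\|(\tilde MH)^+\|\,\|EH\|_F\Big)\|\tilde M\|+O(\|E\|_F^2)$$ $$\le 2\|E\|+\Big(1+\sqrt{2r}\,\|(\tilde MH)^+\|\Big)\|\tilde M\|\,\|EH\|+O(\|E\|_F^2).$$ (ii) Let, in addition, $\tilde M=AG_{r,n}$ be a right factor-Gaussian matrix of rank $r$, where $A\in\mathbb R^{m\times r}$, $\operatorname{rank}(A)=r$, and $G_{r,n}$ is an $r\times n$ Gaussian matrix, and write $\kappa:=\kappa(A)\kappa(H_r)$. Then $$\|M-UV\|\le\Big(2+\big(\|A\|\,\|H\|+\sqrt{2r}\,\nu^+_{\mathrm{sp},r,l}\,\kappa\big)\,\nu_{\mathrm{sp},r,n}\Big)\|E\|+O(\|E\|_F^2).$$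
   Context: $\|\cdot\|$ and $\|\cdot\|_F$ are the spectral and Frobenius norms; $X^+$ is the Moore–Penrose pseudo inverse; $\kappa(X)=\|X\|\,\|X^+\|$; $X_r$ is the rank-$r$ truncation of $X$ (set all singular values $\sigma_j(X)$ with $j>r$ to zero in the SVD); $\mathcal R(X)$ is the column span. The numerical rank of a matrix is the minimal rank of a matrix within a small relative norm distance from it. A matrix is Gaussian if its entries are independent standard normal variables. Algorithm: given $M\in\mathbb R^{m\times n}$, a target rank $r$, and $H\in\mathbb R^{n\times l}$ of full numerical rank $l$, compute $MH$; if its numerical rank is less than $r$, output FAILURE (assumed not to occur). Otherwise let $U$ be the $m\times l'$ matrix ($r\le l'\le l$) made up of the $l'$ leftmost columns of the (orthonormal-column) factor $Q$ of a rank-revealing QR factorization of $MH$, so that $U$ has rank $r$ and $\mathcal R(MH)\supseteq\mathcal R(U)\supseteq\mathcal R((MH)_r)$, and let $V:=U^+M$. Output $U$ and $V$. $\nu_{\mathrm{sp},r,n}:=\|G_{r,n}\|$ and $\nu^+_{\mathrm{sp},r,l}:=\|G_{r,l}^+\|$, where $G_{r,l}:=G_{r,n}S_H$ is an $r\times l$ Gaussian matrix and $H=S_H\Sigma_HT_H^*$ is the compact SVD of $H$. The terms $O(\|E\|_F^2)$ collect the values of order $\|E\|_F^2$ as $E\to0$ with $\tilde M$ and $H$ fixed.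
   Formalization: In (i), M̃H≠0 is assumed and both expressions are proved as bounds of ‖M−UV‖, not compared with each other; in (ii), almost surely, the printed bound is proved if R(U)=R(MH), and in general with κ(A)κ(H) in place of κ(A)κ(H_r), since as printed it fails. *)

theory Defs
  imports "HOL-Probability.Probability"
begin

text \<open>
  An m by n matrix is an element of \<open>real ^ 'n ^ 'm\<close>. Index types that carry an ordering of rows or
  columns (diagonals, triangular factors, leftmost columns) are of class \<open>{finite, wellorder}\<close>.
  Indices of two different types are compared through their zero-based position.
\<close>

definition pos :: "'n::{finite,wellorder} \<Rightarrow> nat" where
  "pos i = card {..<i}"

definition spec_norm :: "real ^ 'n ^ 'm \<Rightarrow> real" where
  "spec_norm X = onorm (\<lambda>x. X *v x)"

definition frob_norm :: "real ^ 'n ^ 'm \<Rightarrow> real" where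
  "frob_norm X = sqrt (\<Sum>i\<in>UNIV. \<Sum>j\<in>UNIV. (X $ i $ j)\<^sup>2)"

definition is_pinv :: "real ^ 'n ^ 'm \<Rightarrow> real ^ 'm ^ 'n \<Rightarrow> bool" where
  "is_pinv X Y \<longleftrightarrow>
     X ** Y ** X = X \<and> Y ** X ** Y = Y \<and>
     transpose (X ** Y) = X ** Y \<and> transpose (Y ** X) = Y ** X"

definition pinv :: "real ^ 'n ^ 'm \<Rightarrow> real ^ 'm ^ 'n" where
  "pinv X = (THE Y. is_pinv X Y)"

definition cond_number :: "real ^ 'n ^ 'm \<Rightarrow> real" where
  "cond_number X = spec_norm X * spec_norm (pinv X)"

definition col_span :: "real ^ 'n ^ 'm \<Rightarrow> (real ^ 'm) set" where
  "col_span X = span (columns X)"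

definition is_svd ::
  "real ^ 'm::{finite,wellorder} ^ 'm::{finite,wellorder} \<Rightarrow> real ^ 'n::{finite,wellorder} ^ 'm::{finite,wellorder} \<Rightarrow> real ^ 'n::{finite,wellorder} ^ 'n::{finite,wellorder} \<Rightarrow>
   real ^ 'n::{finite,wellorder} ^ 'm::{finite,wellorder} \<Rightarrow> bool" where
  "is_svd S D T X \<longleftrightarrow>
     orthogonal_matrix S \<and> orthogonal_matrix T \<and> X = S ** D ** transpose T \<and>
     (\<forall>i j. pos i \<noteq> pos j \<longrightarrow> D $ i $ j = 0) \<and>
     (\<forall>i j. pos i = pos j \<longrightarrow> 0 \<le> D $ i $ j) \<and>
     (\<forall>i j i' j'. pos i = pos j \<longrightarrow> pos i' = pos j' \<longrightarrow> pos i \<le> pos i' \<longrightarrow>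
        D $ i' $ j' \<le> D $ i $ j)"

text \<open>
  \<open>Y\<close> is \<open>X\<^sub>r\<close>. This is a relation because \<open>X\<^sub>r\<close> depends on the chosen SVD when
  \<open>\<sigma>\<^sub>r(X) = \<sigma>\<^sub>r\<^sub>+\<^sub>1(X)\<close>. Positions are zero-based, so the singular values
  \<open>\<sigma>\<^sub>1(X), \<dots>, \<sigma>\<^sub>r(X)\<close> occupy the positions below \<open>r\<close>.
\<close>

definition is_truncation ::
  "nat \<Rightarrow> real ^ 'n::{finite,wellorder} ^ 'm::{finite,wellorder} \<Rightarrow>
   real ^ 'n::{finite,wellorder} ^ 'm::{finite,wellorder} \<Rightarrow> bool" where
  "is_truncation r X Y \<longleftrightarrow>
     (\<exists>S D T. is_svd S D T X \<and>
        Y = S ** (\<chi> i j. if pos i < r then D $ i $ j else 0) ** transpose T)"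

definition is_compact_svd ::
  "real ^ 'k::{finite,wellorder} ^ 'm \<Rightarrow>
   real ^ 'k::{finite,wellorder} ^ 'k::{finite,wellorder} \<Rightarrow>
   real ^ 'k::{finite,wellorder} ^ 'n \<Rightarrow> real ^ 'n ^ 'm \<Rightarrow> bool" where
  "is_compact_svd S D T X \<longleftrightarrow>
     CARD('k) = rank X \<and>
     transpose S ** S = mat 1 \<and> transpose T ** T = mat 1 \<and> X = S ** D ** transpose T \<and>
     (\<forall>i j. i \<noteq> j \<longrightarrow> D $ i $ j = 0) \<and> (\<forall>i. 0 < D $ i $ i) \<and>
     (\<forall>i j. i \<le> j \<longrightarrow> D $ j $ j \<le> D $ i $ i)"

text \<open>The parameter \<open>\<epsilon>\<close> is the tolerance implicit in the notion of numerical rank.\<close>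

definition numerical_rank :: "real \<Rightarrow> real ^ 'n ^ 'm \<Rightarrow> nat" where
  "numerical_rank \<epsilon> X =
     (LEAST k. \<exists>Y :: real ^ 'n ^ 'm. rank Y = k \<and> spec_norm (X - Y) \<le> \<epsilon> * spec_norm X)"

text \<open>
  \<open>X P = Q R\<close> with the full m by m factor \<open>Q\<close>; the columns of a thin factor are its leading
  columns. Classically \<open>P\<close> is a permutation matrix. Any orthogonal \<open>P\<close> is admitted here, because
  the range condition imposed on the leftmost columns of \<open>Q\<close> below cannot in general be met with a
  permutation unless these columns span all of the column span of \<open>X\<close>.
\<close>

definition is_pivoted_qr ::
  "real ^ 'n::{finite,wellorder} ^ 'm::{finite,wellorder} \<Rightarrow>
   real ^ 'm::{finite,wellorder} ^ 'm::{finite,wellorder} \<Rightarrow>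
   real ^ 'n::{finite,wellorder} ^ 'm::{finite,wellorder} \<Rightarrow>
   real ^ 'n::{finite,wellorder} ^ 'n::{finite,wellorder} \<Rightarrow> bool" where
  "is_pivoted_qr X Q R P \<longleftrightarrow>
     orthogonal_matrix Q \<and> orthogonal_matrix P \<and> X ** P = Q ** R \<and>
     (\<forall>i j. pos j < pos i \<longrightarrow> R $ i $ j = 0)"

definition leftmost_columns ::
  "real ^ 'k::{finite,wellorder} ^ 'm \<Rightarrow> real ^ 'p::{finite,wellorder} ^ 'm \<Rightarrow> bool" where
  "leftmost_columns Q U \<longleftrightarrow> (\<forall>c. \<exists>k. pos k = pos c \<and> column c U = column k Q)"

text \<open>
  \<open>U\<close> and \<open>V\<close> are a possible output of the range finder on \<open>M\<close>, \<open>r\<close>, \<open>H\<close> (the first conjunct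
  says that it does not report FAILURE); \<open>l' = CARD('p)\<close>. The range condition is what makes the QR
  factorization rank-revealing. As the columns of \<open>U\<close> are orthonormal, its rank is \<open>l'\<close>, and
  requiring rank exactly \<open>r\<close> would force \<open>l' = r\<close>. Rank at least \<open>r\<close> covers this case as well as
  all other \<open>l'\<close>.
\<close>

definition range_finder_output ::
  "real \<Rightarrow> nat \<Rightarrow> real ^ 'n ^ 'm::{finite,wellorder} \<Rightarrow>
   real ^ 'l::{finite,wellorder} ^ 'n \<Rightarrow>
   real ^ 'p::{finite,wellorder} ^ 'm::{finite,wellorder} \<Rightarrow>
   real ^ 'n ^ 'p::{finite,wellorder} \<Rightarrow> bool" where
  "range_finder_output \<epsilon> r M H U V \<longleftrightarrow>
     r \<le> numerical_rank \<epsilon> (M ** H) \<and>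
     r \<le> CARD('p) \<and> CARD('p) \<le> CARD('l) \<and>
     (\<exists>Q R P. is_pivoted_qr (M ** H) Q R P \<and> leftmost_columns Q U) \<and>
     r \<le> rank U \<and>
     col_span U \<subseteq> col_span (M ** H) \<and>
     (\<exists>Y. is_truncation r (M ** H) Y \<and> col_span Y \<subseteq> col_span U) \<and>
     V = pinv U ** M"

definition gaussian_matrix :: "'w measure \<Rightarrow> ('w \<Rightarrow> real ^ 'n ^ 'm) \<Rightarrow> bool" where
  "gaussian_matrix \<Omega> G \<longleftrightarrow>
     prob_space \<Omega> \<and>
     (\<forall>i j. distributed \<Omega> lborel (\<lambda>\<omega>. G \<omega> $ i $ j) std_normal_density) \<and>
     prob_space.indep_vars \<Omega> (\<lambda>_. borel) (\<lambda>(i, j) \<omega>. G \<omega> $ i $ j) UNIV"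

end

theory Submission
  imports Defs
begin

text \<open>
  Let \<open>P\<close> be the orthogonal projection onto the range of \<open>U\<close>, so that \<open>M - U V = (I - P) M\<close> and
  only \<open>(I - P) Mt\<close> has to be bounded. Write \<open>N = Mt H\<close>, \<open>F = E H\<close>, and split \<open>M H = B + C\<close> with
  \<open>B\<close> the rank-\<open>r\<close> truncation. As \<open>N\<close> has the same range as \<open>Mt\<close>,
  \<open>(I - P) Mt = (I - P) N N\<^sup>+ Mt = (I - P) (C - F) N\<^sup>+ Mt\<close>. Here \<open>C\<close> has norm at most that of \<open>F\<close>,
  and since the rows of \<open>B\<close> are orthogonal to those of \<open>C\<close>, the product \<open>C N\<^sup>T\<close>, hence also
  \<open>C N\<^sup>+\<close>, is of second order. For a factor-Gaussian matrix, \<open>N = A (G S) (D T\<^sup>T)\<close> has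
  \<open>Z = H\<^sup>+ S (G S)\<^sup>+ A\<^sup>+\<close> as a generalized inverse (\<open>N Z N = N\<close>), and the norm of \<open>N\<^sup>+\<close> is minimal
  among those. The only event to be excluded is \<open>G S = 0\<close>: if \<open>N\<close> is nonzero but has rank
  below \<open>r\<close>, then the algorithm fails for all small \<open>E\<close>.
\<close>

subsection \<open>Matrix arithmetic\<close>

lemma matrix_diff_ldistrib: "A ** (B - C) = A ** B - A ** C"
  for A :: "real ^ 'n ^ 'm" and B C :: "real ^ 'p ^ 'n"
  by (simp add: matrix_eq matrix_vector_mult_diff_rdistrib matrix_vector_mult_diff_distrib flip: matrix_vector_mul_assoc)

lemma matrix_diff_rdistrib: "(A - B) ** C = A ** C - B ** C"
  for A B :: "real ^ 'n ^ 'm" and C :: "real ^ 'p ^ 'n"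
  by (simp add: matrix_eq matrix_vector_mult_diff_rdistrib matrix_vector_mult_diff_distrib flip: matrix_vector_mul_assoc)

lemma matrix_add_rdistrib: "(A + B) ** C = A ** C + B ** C"
  for A B :: "real ^ 'n ^ 'm" and C :: "real ^ 'p ^ 'n"
  by (simp add: matrix_eq matrix_vector_mult_add_rdistrib flip: matrix_vector_mul_assoc)

lemma matrix_mult_0_left: "0 ** A = (0 :: real ^ 'p ^ 'm)" for A :: "real ^ 'p ^ 'n"
  by (simp add: vec_eq_iff matrix_matrix_mult_def)

lemma matrix_mult_0_right: "A ** 0 = (0 :: real ^ 'p ^ 'm)" for A :: "real ^ 'n ^ 'm"
  by (simp add: vec_eq_iff matrix_matrix_mult_def)

subsection \<open>Spectral and Frobenius norm\<close>

lemma spec_norm_nonneg: "0 \<le> spec_norm X" for X :: "real ^ 'n ^ 'm"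
  unfolding spec_norm_def by (rule onorm_pos_le) simp

lemma spec_norm_bound: "norm (X *v x) \<le> spec_norm X * norm x" for X :: "real ^ 'n ^ 'm"
  unfolding spec_norm_def by (rule onorm) simp

lemma spec_norm_le:
  fixes X :: "real ^ 'n ^ 'm"
  assumes "\<And>x. norm (X *v x) \<le> b * norm x"
  shows "spec_norm X \<le> b"
  unfolding spec_norm_def using assms by (rule onorm_le)

lemma spec_norm_mult: "spec_norm (X ** Y) \<le> spec_norm X * spec_norm Y"
  for X :: "real ^ 'n ^ 'm" and Y :: "real ^ 'p ^ 'n"
  unfolding spec_norm_def
  using onorm_compose[of "(*v) X" "(*v) Y"] by (simp add: o_def matrix_vector_mul_assoc)

lemma spec_norm_add: "spec_norm (X + Y) \<le> spec_norm X + spec_norm Y"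
  for X Y :: "real ^ 'n ^ 'm"
  unfolding spec_norm_def
  using onorm_triangle[of "(*v) X" "(*v) Y"] by (simp flip: matrix_vector_mult_add_rdistrib)

lemma spec_norm_uminus: "spec_norm (- X) = spec_norm X" for X :: "real ^ 'n ^ 'm"
proof -
  have "(- X) *v x = - (X *v x)" for x
    by (simp add: vec_eq_iff matrix_vector_mult_def sum_negf)
  then show ?thesis
    by (simp add: spec_norm_def onorm_neg)
qed

lemma spec_norm_diff: "spec_norm (X - Y) \<le> spec_norm X + spec_norm Y"
  for X Y :: "real ^ 'n ^ 'm"
  using spec_norm_add[of X "- Y"] by (simp add: spec_norm_uminus)

lemma spec_norm_eq_0: "spec_norm X = 0 \<longleftrightarrow> X = 0" for X :: "real ^ 'n ^ 'm"
  unfolding spec_norm_def by (subst onorm_eq_0) (auto simp: matrix_eq)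

text \<open>The squared norm of \<open>transpose Y *v x\<close> is the inner product of
  \<open>x\<close> with \<open>Y *v (transpose Y *v x)\<close>. Cauchy-Schwarz and cancelling one
  factor give one inequality; applying it to the transpose gives the other.\<close>

lemma spec_norm_transpose: "spec_norm (transpose X) = spec_norm X" for X :: "real ^ 'n ^ 'm"
proof -
  have le: "spec_norm (transpose Y) \<le> spec_norm Y" for Y :: "real ^ 'a ^ 'b"
  proof (rule spec_norm_le)
    fix x
    let ?y = "transpose Y *v x"
    have "norm ?y * norm ?y = x \<bullet> (Y *v ?y)"
      by (metis dot_lmul_matrix norm_eq_sqrt_inner inner_commute real_sqrt_mult_self abs_of_nonneg inner_ge_zero transpose_matrix_vector)
    also have "\<dots> \<le> norm x * (spec_norm Y * norm ?y)"
      using norm_cauchy_schwarz[of x "Y *v ?y"] mult_left_mono[OF spec_norm_bound norm_ge_zero]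
      by (rule order_trans)
    finally have "norm ?y * norm ?y \<le> (spec_norm Y * norm x) * norm ?y"
      by (simp add: mult_ac)
    then show "norm ?y \<le> spec_norm Y * norm x"
      using spec_norm_nonneg[of Y] by (cases "?y = 0") (auto simp: mult_le_cancel_right)
  qed
  show ?thesis
    using le[of X] le[of "transpose X"] by (simp add: transpose_transpose)
qed

lemma frob_norm_nonneg: "0 \<le> frob_norm X"
  by (simp add: frob_norm_def sum_nonneg)

text \<open>Cauchy-Schwarz applied row by row.\<close>

lemma spec_norm_le_frob_norm: "spec_norm X \<le> frob_norm X" for X :: "real ^ 'n ^ 'm"
proof (rule spec_norm_le)
  fix x
  have row: "(norm (X $ i))\<^sup>2 = (\<Sum>j\<in>UNIV. (X $ i $ j)\<^sup>2)" for i
    by (simp add: norm_vec_def L2_set_def sum_nonneg)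
  have "(norm (X *v x))\<^sup>2 = (\<Sum>i\<in>UNIV. (X $ i \<bullet> x)\<^sup>2)"
    by (simp add: norm_vec_def L2_set_def sum_nonneg matrix_mult_dot)
  also have "\<dots> \<le> (\<Sum>i\<in>UNIV. (norm (X $ i) * norm x)\<^sup>2)"
    by (intro sum_mono) (metis Cauchy_Schwarz_ineq2 abs_ge_zero power2_abs power_mono)
  also have "\<dots> = (frob_norm X * norm x)\<^sup>2"
    by (simp add: frob_norm_def power_mult_distrib row sum_nonneg flip: sum_distrib_right)
  finally show "norm (X *v x) \<le> frob_norm X * norm x"
    by (rule power2_le_imp_le) (simp add: frob_norm_nonneg)
qed

section \<open>Isometries and orthogonal projections\<close>

lemma spec_norm_isometry:
  fixes X :: "real ^ 'n ^ 'm"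
  assumes "transpose X ** X = mat 1"
  shows "spec_norm X \<le> 1"
proof (rule spec_norm_le)
  fix x
  have "norm (X *v x) = norm x"
    by (metis assms dot_lmul_matrix matrix_vector_mul_assoc matrix_vector_mul_lid
        norm_eq transpose_matrix_vector inner_commute)
  then show "norm (X *v x) \<le> 1 * norm x" by simp
qed

text \<open>Symmetry and idempotence turn the squared norm of \<open>P *v x\<close> into the inner
  product of \<open>x\<close> with \<open>P *v x\<close>, to which Cauchy-Schwarz applies.\<close>

lemma spec_norm_projection:
  fixes P :: "real ^ 'n ^ 'n"
  assumes "transpose P = P" "P ** P = P"
  shows "spec_norm P \<le> 1"
proof (rule spec_norm_le)
  fix x
  have "norm (P *v x) * norm (P *v x) = (P *v x) \<bullet> (P *v x)"
    by (simp add: power2_norm_eq_inner flip: power2_eq_square)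
  also have "\<dots> = x \<bullet> (P *v x)"
    by (metis assms dot_lmul_matrix matrix_vector_mul_assoc transpose_matrix_vector)
  also have "\<dots> \<le> norm x * norm (P *v x)"
    by (rule norm_cauchy_schwarz)
  finally show "norm (P *v x) \<le> 1 * norm x"
    by (cases "P *v x = 0") (auto simp: mult_le_cancel_right)
qed

lemma spec_norm_projection_complement:
  fixes P :: "real ^ 'n ^ 'n"
  assumes "transpose P = P" "P ** P = P"
  shows "spec_norm (mat 1 - P) \<le> 1"
proof (rule spec_norm_projection)
  show "transpose (mat 1 - P) = mat 1 - P"
    using assms(1) by (simp add: vec_eq_iff transpose_def mat_def)
  show "(mat 1 - P) ** (mat 1 - P) = mat 1 - P"
    using assms(2) by (simp add: matrix_eq matrix_vector_mult_diff_rdistrib matrix_vector_mult_diff_distrib flip: matrix_vector_mul_assoc)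
qed

subsection \<open>Pseudo inverse\<close>

text \<open>\<open>P\<close> is the sum of the outer products of the vectors of an orthonormal basis
  of \<open>W\<close> with themselves.\<close>

lemma projection_exists:
  fixes W :: "(real ^ 'n) set"
  assumes "subspace W"
  obtains P :: "real ^ 'n ^ 'n"
  where "transpose P = P" "\<And>x. P *v x \<in> W" "\<And>x. x \<in> W \<Longrightarrow> P *v x = x"
proof -
  obtain B where B: "B \<subseteq> W" "pairwise orthogonal B" "\<And>x. x \<in> B \<Longrightarrow> norm x = 1"
      "independent B" "span B = W"
    using orthonormal_basis_subspace[OF assms] by metis
  have fin: "finite B" using B(4) independent_imp_finite by blast
  define P :: "real ^ 'n ^ 'n" where "P = (\<chi> i j. \<Sum>b\<in>B. b $ i * b $ j)"
  have P: "P *v x = (\<Sum>b\<in>B. (x \<bullet> b) *\<^sub>R b)" for x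
  proof -
    have "(\<Sum>j\<in>UNIV. (\<Sum>b\<in>B. b $ i * b $ j) * x $ j) = (\<Sum>b\<in>B. (\<Sum>j\<in>UNIV. x $ j * b $ j) * b $ i)" for i
      unfolding sum_distrib_right by (subst sum.swap) (simp add: mult_ac)
    then show ?thesis
      by (simp add: vec_eq_iff matrix_vector_mult_def P_def inner_vec_def)
  qed
  show ?thesis
  proof
    show "transpose P = P" by (simp add: P_def transpose_def mult.commute)
    show "P *v x \<in> W" for x
      unfolding P using B(1) assms by (auto intro!: subspace_sum subspace_scale)
    show "P *v x = x" if "x \<in> W" for x
      unfolding P using orthonormal_basis_expand[OF B(2,3)] that B(5) fin by auto
  qed
qed

text \<open>A linear right inverse of \<open>X\<close> on its range already satisfies the first
  Penrose equation; the other three are enforced afterwards by orthogonal projections.\<close>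

lemma generalized_inverse_exists:
  fixes X :: "real ^ 'n ^ 'm"
  obtains Y :: "real ^ 'm ^ 'n" where "X ** Y ** X = X"
proof -
  obtain g where g: "linear g" "\<And>v. v \<in> range ((*v) X) \<Longrightarrow> X *v g v = v"
    using linear_exists_right_inverse_on[OF matrix_vector_mul_linear[of X] subspace_UNIV] by blast
  have "X ** matrix g ** X = X"
    using g by (simp add: matrix_eq matrix_works flip: matrix_vector_mul_assoc)
  then show ?thesis ..
qed

lemma projection_fixes:
  fixes X :: "real ^ 'n ^ 'm"
  assumes "\<And>x. x \<in> range ((*v) X) \<Longrightarrow> P *v x = x"
  shows "P ** X = X"
  using assms by (simp add: matrix_eq flip: matrix_vector_mul_assoc)

text \<open>Take any generalized inverse \<open>Y\<close> and the orthogonal projections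
  \<open>P\<close> and \<open>Q\<close> onto the column space and the row space of \<open>X\<close>.
  Then \<open>Q ** Y ** P\<close> works: multiplied by \<open>X\<close> it gives \<open>P\<close> on
  one side and \<open>Q\<close> on the other, and both are symmetric.\<close>

lemma pinv_exists: "\<exists>Y. is_pinv X Y" for X :: "real ^ 'n ^ 'm"
proof -
  obtain Y where Y: "X ** Y ** X = X" by (rule generalized_inverse_exists)
  have sub: "subspace (range ((*v) Z))" for Z :: "real ^ 'a ^ 'b"
    using linear_subspace_image[OF matrix_vector_mul_linear subspace_UNIV] .
  obtain P where P: "transpose P = P" "\<And>x. P *v x \<in> range ((*v) X)" "\<And>x. x \<in> range ((*v) X) \<Longrightarrow> P *v x = x"
    using projection_exists[OF sub[of X]] by metis
  obtain Q where Q: "transpose Q = Q" "\<And>x. Q *v x \<in> range ((*v) (transpose X))"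
      "\<And>x. x \<in> range ((*v) (transpose X)) \<Longrightarrow> Q *v x = x"
    using projection_exists[OF sub[of "transpose X"]] by metis
  have PX: "P ** X = X" using projection_fixes[OF P(3)] .
  have "Q ** transpose X = transpose X" using projection_fixes[OF Q(3)] .
  then have XQ: "X ** Q = X"
    by (metis Q(1) matrix_transpose_mul transpose_transpose)
  have XYP: "X ** Y ** P = P"
  proof -
    have "(X ** Y) *v (P *v x) = P *v x" for x
      using P(2)[of x] Y by (metis imageE matrix_vector_mul_assoc)
    then show ?thesis by (simp add: matrix_eq flip: matrix_vector_mul_assoc)
  qed
  \<comment> \<open>The same argument for the transposed matrices: \<open>transpose Y\<close> is a
    generalized inverse of \<open>transpose X\<close>, and \<open>Q\<close> maps into the range of
    the latter.\<close>
  have QYX: "Q ** Y ** X = Q"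
  proof -
    have tY: "transpose X ** transpose Y ** transpose X = transpose X"
      by (metis Y matrix_transpose_mul matrix_mul_assoc)
    have "(transpose X ** transpose Y) *v (Q *v x) = Q *v x" for x
      using Q(2)[of x] tY by (metis imageE matrix_vector_mul_assoc)
    then have "transpose X ** transpose Y ** Q = Q" by (simp add: matrix_eq flip: matrix_vector_mul_assoc)
    then show ?thesis
      by (metis Q(1) matrix_transpose_mul transpose_transpose matrix_mul_assoc)
  qed
  have 1: "X ** (Q ** Y ** P) = P" using XQ XYP by (simp add: matrix_mul_assoc)
  have 2: "Q ** Y ** P ** X = Q" using PX QYX by (simp flip: matrix_mul_assoc)
  have "Q ** (Q ** Y ** P) = Q ** Y ** P"
    using Q(2,3) by (simp add: matrix_eq flip: matrix_vector_mul_assoc)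
  then have "is_pinv X (Q ** Y ** P)"
    using PX P(1) Q(1) by (simp add: is_pinv_def 1 2)
  then show ?thesis ..
qed

text \<open>Replacing \<open>X\<close> by \<open>X ** Z ** X\<close> inside the symmetric product
  \<open>X ** Y\<close> and transposing reverses the factors and yields \<open>X ** Z\<close>. The
  same on the other side gives \<open>Y ** X = Z ** X\<close>, and both equations together identify
  \<open>Y\<close> with \<open>Z\<close>.\<close>

lemma is_pinv_unique:
  fixes X :: "real ^ 'n ^ 'm"
  assumes Y: "is_pinv X Y" and Z: "is_pinv X Z"
  shows "Y = Z"
proof -
  have "X ** Y = transpose ((X ** Z ** X) ** Y)" using Y Z by (simp add: is_pinv_def)
  also have "\<dots> = transpose ((X ** Z) ** (X ** Y))" by (simp add: matrix_mul_assoc)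
  also have "\<dots> = (X ** Y) ** (X ** Z)"
    by (subst matrix_transpose_mul) (use Y Z in \<open>simp add: is_pinv_def\<close>)
  also have "\<dots> = X ** Z" using Y by (simp add: is_pinv_def matrix_mul_assoc)
  finally have XY: "X ** Y = X ** Z" .
  have "Y ** X = transpose (Y ** (X ** Z ** X))" using Y Z by (simp add: is_pinv_def)
  also have "\<dots> = transpose ((Y ** X) ** (Z ** X))" by (simp add: matrix_mul_assoc)
  also have "\<dots> = (Z ** X) ** (Y ** X)"
    by (subst matrix_transpose_mul) (use Y Z in \<open>simp add: is_pinv_def\<close>)
  also have "\<dots> = Z ** (X ** Y ** X)" by (simp add: matrix_mul_assoc)
  also have "\<dots> = Z ** X" using Y by (simp add: is_pinv_def)
  finally have YX: "Y ** X = Z ** X" .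
  have "Y = Y ** X ** Y" using Y by (simp add: is_pinv_def)
  also have "\<dots> = Z ** (X ** Y)" by (simp add: YX matrix_mul_assoc)
  also have "\<dots> = Z" using Z by (simp add: XY is_pinv_def matrix_mul_assoc)
  finally show ?thesis .
qed

lemma pinv_eqI: "is_pinv X Y \<Longrightarrow> pinv X = Y" for X :: "real ^ 'n ^ 'm"
  unfolding pinv_def using is_pinv_unique by blast

lemma is_pinv_pinv: "is_pinv X (pinv X)" for X :: "real ^ 'n ^ 'm"
  using pinv_exists pinv_eqI by metis

lemma pinv_simps:
  fixes X :: "real ^ 'n ^ 'm"
  shows "X ** pinv X ** X = X" "pinv X ** X ** pinv X = pinv X"
    "transpose (X ** pinv X) = X ** pinv X" "transpose (pinv X ** X) = pinv X ** X"
  using is_pinv_pinv[of X] by (simp_all add: is_pinv_def)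

lemma spec_norm_mult3:
  "spec_norm (X ** Y ** Z) \<le> spec_norm X * spec_norm Y * spec_norm Z"
  for X :: "real ^ 'n ^ 'm" and Y :: "real ^ 'p ^ 'n" and Z :: "real ^ 'q ^ 'p"
  by (rule order_trans[OF spec_norm_mult mult_right_mono[OF spec_norm_mult spec_norm_nonneg]])

text \<open>The pseudo inverse arises from \<open>Z\<close> by multiplying with the orthogonal
  projections \<open>pinv X ** X\<close> and \<open>X ** pinv X\<close>, which do not increase the
  norm. So a pseudo inverse can be bounded without being computed.\<close>

lemma spec_norm_pinv_le:
  fixes X :: "real ^ 'n ^ 'm"
  assumes "X ** Z ** X = X"
  shows "spec_norm (pinv X) \<le> spec_norm Z"
proof -
  let ?Y = "pinv X"
  have "?Y = ?Y ** (X ** Z ** X) ** ?Y"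
    by (simp add: assms pinv_simps)
  also have "\<dots> = (?Y ** X) ** Z ** (X ** ?Y)"
    by (simp add: matrix_mul_assoc)
  finally have "spec_norm ?Y \<le> spec_norm (?Y ** X) * spec_norm Z * spec_norm (X ** ?Y)"
    by (metis spec_norm_mult3)
  also have "\<dots> \<le> 1 * spec_norm Z * 1"
    by (intro mult_mono spec_norm_projection mult_nonneg_nonneg spec_norm_nonneg)
      (simp_all add: matrix_mul_assoc pinv_simps)
  finally show ?thesis by simp
qed

lemma cond_number_ge_1:
  fixes X :: "real ^ 'n ^ 'm"
  assumes "X \<noteq> 0"
  shows "1 \<le> cond_number X"
proof -
  have "spec_norm X = spec_norm (X ** pinv X ** X)"
    by (simp add: pinv_simps)
  also have "\<dots> \<le> cond_number X * spec_norm X"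
    unfolding cond_number_def by (rule spec_norm_mult3)
  finally show ?thesis
    using assms spec_norm_eq_0[of X] spec_norm_nonneg[of X] by simp
qed

subsection \<open>Singular value truncation\<close>

lemma inj_pos: "inj pos"
proof (rule linorder_injI)
  fix i j :: 'a
  assume "i < j"
  then have "{..<i} \<subset> {..<j}" by auto
  then show "pos i \<noteq> pos j"
    unfolding pos_def using psubset_card_mono[of "{..<j}" "{..<i}"] by simp
qed

lemma pos_eq_iff: "pos i = pos j \<longleftrightarrow> i = j"
  using inj_pos by (auto dest: injD)

lemma range_pos: "range (pos :: 'a::{finite,wellorder} \<Rightarrow> nat) = {..<CARD('a)}"
proof (rule card_subset_eq)
  have "pos i < CARD('a)" for i :: 'a
    unfolding pos_def by (rule psubset_card_mono) auto
  then show "range (pos :: 'a \<Rightarrow> nat) \<subseteq> {..<CARD('a)}" by auto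
  show "card (range (pos :: 'a \<Rightarrow> nat)) = card {..<CARD('a)}"
    by (simp add: card_image inj_pos)
qed simp

text \<open>Positions start at zero, so the bound \<open>r\<close> admits one index more than a rank
  of \<open>r\<close>; the dimension count for the truncation error rests on this surplus.\<close>

lemma card_pos_le:
  assumes "r < CARD('a::{finite,wellorder})"
  shows "card {k :: 'a. pos k \<le> r} = Suc r"
proof -
  have "pos ` {k :: 'a. pos k \<le> r} = {..r}"
  proof
    show "{..r} \<subseteq> pos ` {k :: 'a. pos k \<le> r}"
    proof
      fix t assume "t \<in> {..r}"
      then have "t \<in> range (pos :: 'a \<Rightarrow> nat)" using assms by (simp add: range_pos)
      then show "t \<in> pos ` {k :: 'a. pos k \<le> r}" using \<open>t \<in> {..r}\<close> by auto
    qed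
  qed auto
  then show ?thesis
    by (metis card_atMost card_image inj_on_subset inj_pos subset_UNIV)
qed

section \<open>Rectangular diagonal matrices\<close>

definition pos_diagonal :: "real ^ 'n::{finite,wellorder} ^ 'm::{finite,wellorder} \<Rightarrow> bool" where
  "pos_diagonal D \<longleftrightarrow> (\<forall>i j. pos i \<noteq> pos j \<longrightarrow> D $ i $ j = 0)"

text \<open>Each row has at most one nonzero entry, so squaring a row sum produces no cross terms.
  The inner sum is the square of the diagonal entry of column \<open>j\<close>, or zero if no row
  has that position.\<close>

lemma norm_pos_diagonal:
  fixes D :: "real ^ 'n::{finite,wellorder} ^ 'm::{finite,wellorder}"
  assumes "pos_diagonal D"
  shows "(norm (D *v y))\<^sup>2 = (\<Sum>j\<in>UNIV. (\<Sum>i\<in>UNIV. (D $ i $ j)\<^sup>2) * (y $ j)\<^sup>2)"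
proof -
  have row: "(\<Sum>j\<in>UNIV. D $ i $ j * y $ j)\<^sup>2 = (\<Sum>j\<in>UNIV. (D $ i $ j)\<^sup>2 * (y $ j)\<^sup>2)" for i
  proof (cases "\<exists>k :: 'n. pos i = pos k")
    case True
    then obtain k :: 'n where "pos i = pos k" by blast
    then have "j \<noteq> k \<Longrightarrow> D $ i $ j = 0" for j
      using assms pos_eq_iff unfolding pos_diagonal_def by metis
    then have "(\<Sum>j\<in>UNIV. D $ i $ j * y $ j) = (\<Sum>j\<in>{k}. D $ i $ j * y $ j)"
      "(\<Sum>j\<in>UNIV. (D $ i $ j)\<^sup>2 * (y $ j)\<^sup>2) = (\<Sum>j\<in>{k}. (D $ i $ j)\<^sup>2 * (y $ j)\<^sup>2)"
      by (intro sum.mono_neutral_right; force)+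
    then show ?thesis by (simp add: power_mult_distrib)
  next
    case False
    then have "D $ i $ j = 0" for j using assms unfolding pos_diagonal_def by metis
    then show ?thesis by simp
  qed
  have "(norm (D *v y))\<^sup>2 = (\<Sum>i\<in>UNIV. (\<Sum>j\<in>UNIV. D $ i $ j * y $ j)\<^sup>2)"
    by (simp add: norm_vec_def L2_set_def sum_nonneg matrix_vector_mult_def)
  also have "\<dots> = (\<Sum>j\<in>UNIV. (\<Sum>i\<in>UNIV. (D $ i $ j)\<^sup>2) * (y $ j)\<^sup>2)"
    unfolding row sum_distrib_right by (rule sum.swap)
  finally show ?thesis .
qed

text \<open>Each column also has at most one nonzero entry, so every coefficient in
  \<open>norm_pos_diagonal\<close> is at most the square of \<open>b\<close>.\<close>

lemma spec_norm_pos_diagonal_le: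
  fixes D :: "real ^ 'n::{finite,wellorder} ^ 'm::{finite,wellorder}"
  assumes "pos_diagonal D" "\<And>i j. \<bar>D $ i $ j\<bar> \<le> b" "0 \<le> b"
  shows "spec_norm D \<le> b"
proof (rule spec_norm_le)
  fix y
  have col: "(\<Sum>i\<in>UNIV. (D $ i $ j)\<^sup>2) \<le> b\<^sup>2" for j
  proof (cases "\<exists>k :: 'm. pos k = pos j")
    case True
    then obtain k :: 'm where "pos k = pos j" by blast
    then have "i \<noteq> k \<Longrightarrow> D $ i $ j = 0" for i
      using assms(1) pos_eq_iff unfolding pos_diagonal_def by metis
    then have "(\<Sum>i\<in>UNIV. (D $ i $ j)\<^sup>2) = (\<Sum>i\<in>{k}. (D $ i $ j)\<^sup>2)"
      by (intro sum.mono_neutral_right; force)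
    then show ?thesis using assms(2)[of k j] assms(3) by (simp add: abs_le_square_iff[symmetric])
  next
    case False
    then have "D $ i $ j = 0" for i using assms(1) unfolding pos_diagonal_def by metis
    then show ?thesis by simp
  qed
  have "(norm (D *v y))\<^sup>2 \<le> (\<Sum>j\<in>UNIV. b\<^sup>2 * (y $ j)\<^sup>2)"
    unfolding norm_pos_diagonal[OF assms(1)] by (intro sum_mono mult_right_mono col) simp
  also have "\<dots> = (b * norm y)\<^sup>2"
    by (simp add: norm_vec_def L2_set_def sum_nonneg power_mult_distrib sum_distrib_left)
  finally show "norm (D *v y) \<le> b * norm y"
    by (rule power2_le_imp_le) (simp add: assms(3))
qed

lemma norm_orthogonal_matrix: "orthogonal_matrix S \<Longrightarrow> norm (S *v x) = norm x"
  for S :: "real ^ 'n ^ 'n"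
  unfolding orthogonal_matrix
  by (metis dot_lmul_matrix matrix_vector_mul_assoc matrix_vector_mul_lid norm_eq transpose_matrix_vector)

text \<open>The leading coordinates span a space of dimension \<open>r + 1\<close>, which exceeds
  the rank, so \<open>X\<close> identifies two of its points; \<open>z\<close> is their
  difference.\<close>

lemma kernel_meets_leading_coordinates:
  fixes X :: "real ^ 'n::{finite,wellorder} ^ 'm"
  assumes "rank X \<le> r" "r < CARD('n)"
  obtains z where "z \<noteq> 0" "X *v z = 0" "\<And>k. r < pos k \<Longrightarrow> z $ k = 0"
proof -
  let ?V = "{z :: real ^ 'n::{finite,wellorder}. \<forall>k. k \<notin> {k. pos k \<le> r} \<longrightarrow> z $ k = 0}"
  have V: "subspace ?V" by (auto simp: subspace_def)
  have dimV: "dim ?V = Suc r"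
    using dim_substandard_cart[of "{k :: 'n. pos k \<le> r}", where ?'a = real] card_pos_le[OF assms(2)]
    by (simp add: dim_vec_eq)
  have "\<not> inj_on ((*v) X) ?V"
  proof
    assume "inj_on ((*v) X) ?V"
    moreover have "span ?V = ?V" using V by (rule span_eq_iff[THEN iffD2])
    ultimately have "Suc r = dim ((*v) X ` ?V)"
      using dim_image_eq[OF matrix_vector_mul_linear[of X], of ?V] dimV by (simp only:)
    also have "\<dots> \<le> rank X"
      unfolding rank_dim_range by (rule dim_subset) auto
    finally show False using assms(1) by simp
  qed
  then obtain x y where "x \<in> ?V" "y \<in> ?V" "x \<noteq> y" "X *v x = X *v y"
    unfolding inj_on_def by blast
  then show ?thesis
    by (intro that[of "x - y"]) (auto simp: matrix_vector_mult_diff_distrib)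
qed

text \<open>Truncation and remainder use disjoint sets of right singular vectors, hence their rows
  are orthogonal. The second claim is the optimality half of the Eckart-Young theorem for the
  spectral norm.\<close>

lemma truncation_remainder:
  fixes X Y N :: "real ^ 'n::{finite,wellorder} ^ 'm::{finite,wellorder}"
  assumes tr: "is_truncation r X Y" and rk: "rank N \<le> r"
  shows "(X - Y) ** transpose Y = 0" "spec_norm (X - Y) \<le> spec_norm (X - N)"
proof -
  obtain S D T where svd: "is_svd S D T X"
    and Y: "Y = S ** (\<chi> i j. if pos i < r then D $ i $ j else 0) ** transpose T"
    using tr unfolding is_truncation_def by blast
  note svd = svd[unfolded is_svd_def]
  define D1 D2 where "D1 = (\<chi> i j. if pos i < r then D $ i $ j else 0)"
    and "D2 = (\<chi> i j. if pos i < r then 0 else D $ i $ j)"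
  have S: "orthogonal_matrix S" and T: "orthogonal_matrix T" and X: "X = S ** D ** transpose T"
    and diag: "pos_diagonal D"
    and ge0: "\<And>i j. 0 \<le> D $ i $ j"
    using svd by (auto simp: pos_diagonal_def) (metis order_refl)
  have "D - D1 = D2" by (simp add: D1_def D2_def vec_eq_iff)
  then have XY: "X - Y = S ** D2 ** transpose T"
    unfolding Y X D1_def[symmetric] by (simp flip: matrix_diff_ldistrib matrix_diff_rdistrib)
  have TT: "transpose T ** T = mat 1" using T orthogonal_matrix by blast
  have "(D2 ** transpose D1) $ i $ j = 0" for i j
  proof -
    \<comment> \<open>A nonzero product would put both \<open>i\<close> and \<open>j\<close> at the
      position of \<open>k\<close>, which would then be below \<open>r\<close> and not below
      \<open>r\<close>.\<close>
    have *: "D2 $ i $ k * D1 $ j $ k = 0" for k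
      using diag unfolding pos_diagonal_def D1_def D2_def by simp metis
    show ?thesis by (simp add: matrix_matrix_mult_def transpose_def *[simplified] *)
  qed
  then have D21: "D2 ** transpose D1 = 0" by (simp add: vec_eq_iff)
  have "(X - Y) ** transpose Y = S ** D2 ** (transpose T ** T) ** transpose D1 ** transpose S"
    unfolding XY unfolding Y D1_def[symmetric] by (simp add: matrix_transpose_mul matrix_mul_assoc)
  also have "\<dots> = S ** (D2 ** transpose D1) ** transpose S"
    by (simp add: TT matrix_mul_assoc)
  finally show "(X - Y) ** transpose Y = 0"
    by (simp add: D21 matrix_mult_0_left matrix_mult_0_right)

  have diag2: "pos_diagonal D2" using diag by (simp add: pos_diagonal_def D2_def)
  have "spec_norm (X - Y) \<le> spec_norm S * spec_norm D2 * spec_norm (transpose T)"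
    unfolding XY by (rule spec_norm_mult3)
  also have "\<dots> \<le> 1 * spec_norm D2 * 1"
    using S T by (intro mult_mono mult_nonneg_nonneg spec_norm_nonneg spec_norm_isometry)
      (auto simp: orthogonal_matrix_def)
  also have "\<dots> \<le> spec_norm (X - N)"
  proof (cases "D2 = 0")
    case True
    then show ?thesis by (metis spec_norm_eq_0 mult_1 mult_1_right spec_norm_nonneg)
  next
    case False
    \<comment> \<open>A nonzero entry of \<open>D2\<close> shows that both index types reach
      position \<open>r\<close>, where singular value number \<open>r + 1\<close> sits.\<close>
    then obtain i j where ij: "D2 $ i $ j \<noteq> 0" by (auto simp: vec_eq_iff)
    then have "pos i = pos j" "r \<le> pos i"
      using diag2 by (auto simp: pos_diagonal_def D2_def split: if_splits)
    moreover have "pos i < CARD('m)" "pos j < CARD('n)"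
      using range_pos[where ?'a = 'm] range_pos[where ?'a = 'n] by auto
    ultimately have rm: "r < CARD('m)" and rn: "r < CARD('n)" by auto
    obtain i0 :: 'm where i0: "pos i0 = r" using rm range_pos[where ?'a = 'm] by (metis imageE lessThan_iff)
    obtain j0 :: 'n where j0: "pos j0 = r" using rn range_pos[where ?'a = 'n] by (metis imageE lessThan_iff)
    define \<sigma> where "\<sigma> = D $ i0 $ j0"
    have \<sigma>0: "0 \<le> \<sigma>" by (simp add: \<sigma>_def ge0)
    have "\<bar>D2 $ i $ j\<bar> \<le> \<sigma>" for i j
    proof (cases "pos i = pos j \<and> r \<le> pos i")
      case True
      then have "D $ i $ j \<le> \<sigma>" unfolding \<sigma>_def using svd i0 j0 by simp
      then show ?thesis using True ge0 by (simp add: D2_def)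
    next
      case False
      then have "D2 $ i $ j = 0" using diag by (cases "pos i = pos j") (auto simp: pos_diagonal_def D2_def)
      then show ?thesis using \<sigma>0 by simp
    qed
    then have upper: "spec_norm D2 \<le> \<sigma>"
      using spec_norm_pos_diagonal_le[OF diag2] \<sigma>0 by blast
    \<comment> \<open>Courant--Fischer: a vector in the span of the leading \<open>r + 1\<close> right singular vectors that \<open>N\<close>
      annihilates shows that \<open>\<sigma>\<close>, the singular value number \<open>r + 1\<close> of \<open>X\<close>, is at most the norm of
      \<open>X - N\<close>.\<close>
    have "rank (N ** T) \<le> r" using rk rank_mul_le_left[of N T] by simp
    then obtain z where z: "z \<noteq> 0" "(N ** T) *v z = 0" "\<And>k. r < pos k \<Longrightarrow> z $ k = 0"
      using kernel_meets_leading_coordinates rn by blast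
    \<comment> \<open>Coordinates of \<open>z\<close> beyond position \<open>r\<close> vanish, and
      at the remaining ones the diagonal entry of \<open>D\<close> exists and is at least
      \<open>\<sigma>\<close>.\<close>
    have "(\<sigma> * norm z)\<^sup>2 = (\<Sum>j\<in>UNIV. \<sigma>\<^sup>2 * (z $ j)\<^sup>2)"
      by (simp add: norm_vec_def L2_set_def sum_nonneg power_mult_distrib sum_distrib_left)
    also have "\<dots> \<le> (\<Sum>j\<in>UNIV. (\<Sum>i\<in>UNIV. (D $ i $ j)\<^sup>2) * (z $ j)\<^sup>2)"
    proof (rule sum_mono)
      fix j :: 'n
      show "\<sigma>\<^sup>2 * (z $ j)\<^sup>2 \<le> (\<Sum>i\<in>UNIV. (D $ i $ j)\<^sup>2) * (z $ j)\<^sup>2"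
      proof (cases "pos j \<le> r")
        case True
        then have "pos j \<in> range (pos :: 'm \<Rightarrow> nat)" using rm by (simp add: range_pos)
        then obtain i :: 'm where i: "pos i = pos j" by (metis imageE)
        then have "\<sigma> \<le> D $ i $ j" unfolding \<sigma>_def using svd i0 j0 True by simp
        then have "\<sigma>\<^sup>2 \<le> (D $ i $ j)\<^sup>2" using \<sigma>0 by (rule power_mono)
        also have "\<dots> \<le> (\<Sum>i\<in>UNIV. (D $ i $ j)\<^sup>2)" by (rule member_le_sum) auto
        finally show ?thesis by (rule mult_right_mono) simp
      next
        case False
        then show ?thesis using z(3)[of j] by simp
      qed
    qed
    also have "\<dots> = (norm (D *v z))\<^sup>2" by (rule norm_pos_diagonal[OF diag, symmetric])
    finally have "\<sigma> * norm z \<le> norm (D *v z)" by (rule power2_le_imp_le) simp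
    also have "\<dots> = norm (S *v (D *v z))" using S by (simp add: norm_orthogonal_matrix)
    also have "S *v (D *v z) = (S ** D ** (transpose T ** T)) *v z"
      by (simp add: TT matrix_vector_mul_assoc)
    \<comment> \<open>\<open>N\<close> may be subtracted because \<open>N ** T\<close> annihilates
      \<open>z\<close>.\<close>
    also have "\<dots> = (X - N) *v (T *v z)"
      using z(2) by (simp add: X matrix_diff_rdistrib matrix_vector_mult_diff_rdistrib matrix_mul_assoc matrix_vector_mul_assoc)
    also have "norm \<dots> \<le> spec_norm (X - N) * norm z"
      using spec_norm_bound[of "X - N" "T *v z"] T by (simp add: norm_orthogonal_matrix)
    finally have "\<sigma> \<le> spec_norm (X - N)" using z(1) by simp
    then show ?thesis using upper by simp
  qed
  finally show "spec_norm (X - Y) \<le> spec_norm (X - N)" .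
qed

text \<open>The first diagonal entry survives truncation and is the largest singular value, so its
  vanishing forces all of \<open>D\<close> to vanish. This is what makes the condition number of a
  truncation at least one.\<close>

lemma truncation_nonzero:
  fixes X Y :: "real ^ 'n::{finite,wellorder} ^ 'm::{finite,wellorder}"
  assumes "is_truncation r X Y" "0 < r" "X \<noteq> 0"
  shows "Y \<noteq> 0"
proof
  assume "Y = 0"
  obtain S D T where svd: "is_svd S D T X"
    and Y: "Y = S ** (\<chi> i j. if pos i < r then D $ i $ j else 0) ** transpose T"
    using assms(1) unfolding is_truncation_def by blast
  note svd = svd[unfolded is_svd_def]
  define D1 where "D1 = (\<chi> i j. if pos i < r then D $ i $ j else 0)"
  have "transpose S ** S = mat 1" "transpose T ** T = mat 1"
    using svd by (auto simp: orthogonal_matrix_def)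
  then have "D1 = transpose S ** (S ** D1 ** transpose T) ** T"
    by (metis matrix_mul_assoc matrix_mul_lid matrix_mul_rid)
  then have D1: "D1 = 0"
    using Y \<open>Y = 0\<close> by (simp add: D1_def matrix_mult_0_left matrix_mult_0_right)
  have "0 \<in> range (pos :: 'm \<Rightarrow> nat)" "0 \<in> range (pos :: 'n \<Rightarrow> nat)"
    by (simp_all add: range_pos)
  then obtain i0 :: 'm and j0 :: 'n where 0: "pos i0 = 0" "pos j0 = 0" by (metis imageE)
  have "D1 $ i0 $ j0 = D $ i0 $ j0" using 0 assms(2) by (simp add: D1_def)
  then have D0: "D $ i0 $ j0 = 0" by (simp add: D1)
  have "D $ i $ j = 0" for i j
  proof (cases "pos i = pos j")
    case True
    then have "D $ i $ j \<le> D $ i0 $ j0" "0 \<le> D $ i $ j" using svd 0 by simp_all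
    then show ?thesis using D0 by simp
  next
    case False
    then show ?thesis using svd by simp
  qed
  then have "D = 0" by (simp add: vec_eq_iff)
  then have "X = 0" using svd by (simp add: matrix_mult_0_left matrix_mult_0_right)
  then show False using assms(3) by simp
qed

text \<open>The witness is \<open>T\<close> times the inverse of \<open>D\<close>. It cancels the
  factor \<open>D ** transpose T\<close> from the right, and in particular recovers \<open>S\<close>
  as \<open>H ** W\<close>.\<close>

lemma compact_svd_core_inverse:
  fixes H :: "real ^ 'l ^ 'n"
    and S :: "real ^ 'k::{finite,wellorder} ^ 'n" and D :: "real ^ 'k::{finite,wellorder} ^ 'k::{finite,wellorder}"
  assumes "is_compact_svd S D T H"
  obtains W where "D ** transpose T ** W = mat 1"
proof
  note svd = assms[unfolded is_compact_svd_def]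
  let ?D' = "\<chi> i j. if i = j then inverse (D $ i $ i) else 0"
  have "(D ** ?D') $ i $ j = mat 1 $ i $ j" for i j
  proof -
    have "(D ** ?D') $ i $ j = (\<Sum>k\<in>{j}. D $ i $ k * ?D' $ k $ j)"
      unfolding matrix_matrix_mult_def vec_lambda_beta by (rule sum.mono_neutral_right) auto
    then show ?thesis using svd by (auto simp: mat_def) (metis less_irrefl right_inverse)
  qed
  then have DD: "D ** ?D' = mat 1" by (simp add: vec_eq_iff)
  have "D ** transpose T ** (T ** ?D') = D ** (transpose T ** T) ** ?D'" by (simp add: matrix_mul_assoc)
  then show "D ** transpose T ** (T ** ?D') = mat 1" using svd DD by simp
qed

subsection \<open>Error of the range finder\<close>

lemma transpose_mult_columns: "(transpose X ** X) $ a $ b = column a X \<bullet> column b X"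
  for X :: "real ^ 'n ^ 'm"
  by (simp add: matrix_matrix_mult_def transpose_def inner_vec_def column_def)

text \<open>Since \<open>pos\<close> is injective, different columns of \<open>U\<close> are
  different columns of the orthogonal matrix \<open>Q\<close>.\<close>

lemma leftmost_columns_isometry:
  assumes "orthogonal_matrix Q" "leftmost_columns Q U"
  shows "transpose U ** U = mat 1"
proof -
  have "(transpose U ** U) $ a $ b = mat 1 $ a $ b" for a b
  proof -
    obtain i j where ij: "pos i = pos a" "column a U = column i Q" "pos j = pos b" "column b U = column j Q"
      using assms(2) unfolding leftmost_columns_def by metis
    then have "i = j \<longleftrightarrow> a = b" by (metis pos_eq_iff)
    then show ?thesis
      using assms(1) ij transpose_mult_columns[of Q i j] by (simp add: transpose_mult_columns orthogonal_matrix mat_def)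
  qed
  then show ?thesis by (simp add: vec_eq_iff)
qed

lemma pinv_isometry:
  fixes U :: "real ^ 'p ^ 'm"
  assumes "transpose U ** U = mat 1"
  shows "pinv U = transpose U"
  using assms by (intro pinv_eqI) (simp add: is_pinv_def matrix_transpose_mul flip: matrix_mul_assoc)

lemma col_span_eq_range: "col_span X = range ((*v) X)" for X :: "real ^ 'n ^ 'm"
proof
  show "col_span X \<subseteq> range ((*v) X)"
    unfolding col_span_def columns_image_basis
    by (intro span_minimal linear_subspace_image[OF matrix_vector_mul_linear] subspace_UNIV) auto
  show "range ((*v) X) \<subseteq> col_span X"
    using matrix_vector_mult_in_columnspace[of X] unfolding col_span_def by auto
qed

lemma isometry_projection_fixes:
  fixes U :: "real ^ 'p ^ 'm" and B :: "real ^ 'n ^ 'm"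
  assumes "transpose U ** U = mat 1" "col_span B \<subseteq> col_span U"
  shows "U ** transpose U ** B = B"
proof (rule projection_fixes)
  fix x assume "x \<in> range ((*v) B)"
  then obtain y where "x = U *v y" using assms(2) unfolding col_span_eq_range by blast
  then show "U ** transpose U *v x = x"
    using assms(1) by (metis matrix_mul_assoc matrix_mul_rid matrix_vector_mul_assoc)
qed

text \<open>The range of \<open>X ** H\<close> lies in that of \<open>X\<close> and has the same
  dimension, so they agree; on it \<open>(X ** H) ** pinv (X ** H)\<close> is the identity.\<close>

lemma mult_pinv_of_rank_le:
  fixes X :: "real ^ 'n ^ 'm" and H :: "real ^ 'l ^ 'n"
  assumes "rank X \<le> rank (X ** H)"
  shows "(X ** H) ** pinv (X ** H) ** X = X"
proof (rule projection_fixes)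
  fix x assume x: "x \<in> range ((*v) X)"
  have "range ((*v) (X ** H)) = range ((*v) X)"
    using assms unfolding rank_dim_range
    by (intro subspace_dim_equal linear_subspace_image[OF matrix_vector_mul_linear] subspace_UNIV)
      (auto simp flip: matrix_vector_mul_assoc)
  then obtain y where "x = (X ** H) *v y" using x by blast
  then show "(X ** H) ** pinv (X ** H) *v x = x"
    by (metis matrix_vector_mul_assoc pinv_simps(1))
qed

lemma numerical_rank_less:
  assumes "rank N < r" "spec_norm (X - N) \<le> \<epsilon> * spec_norm X"
  shows "numerical_rank \<epsilon> X < r"
proof -
  have "numerical_rank \<epsilon> X \<le> rank N"
    unfolding numerical_rank_def by (rule Least_le) (use assms in blast)
  then show ?thesis using assms(1) by simp
qed

text \<open>
  If \<open>Mt ** H\<close> had rank below \<open>r\<close>, it would witness a numerical rank below \<open>r\<close> of every nearby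
  \<open>(Mt + E) ** H\<close>, and the algorithm would report FAILURE.
\<close>

lemma range_finder_output_rank:
  fixes Mt :: "real ^ 'n::{finite,wellorder} ^ 'm::{finite,wellorder}"
    and H :: "real ^ 'l::{finite,wellorder} ^ 'n::{finite,wellorder}"
  assumes "0 < \<epsilon>" "Mt ** H \<noteq> 0"
  obtains \<delta> where "0 < \<delta>"
    "\<And>E (U :: real ^ 'p::{finite,wellorder} ^ 'm::{finite,wellorder}) V. frob_norm E < \<delta> \<Longrightarrow>
      range_finder_output \<epsilon> r (Mt + E) H U V \<Longrightarrow> r \<le> rank (Mt ** H)"
proof
  let ?N = "Mt ** H"
  \<comment> \<open>This radius makes \<open>1 + \<epsilon>\<close> times the norm of
    \<open>E ** H\<close> at most \<open>\<epsilon>\<close> times the norm of \<open>?N\<close>. The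
    triangle inequality then gives the bound relative to \<open>(Mt + E) ** H\<close>. The added 1
    keeps the denominator positive.\<close>
  let ?d = "\<epsilon> * spec_norm ?N / ((1 + \<epsilon>) * (spec_norm H + 1))"
  have H: "0 < spec_norm H + 1" using spec_norm_nonneg[of H] by simp
  have "0 < spec_norm ?N" using assms(2) spec_norm_nonneg[of ?N] spec_norm_eq_0[of ?N] by simp
  then show "0 < ?d" using assms(1) H by simp
  fix E and U :: "real ^ 'p::{finite,wellorder} ^ 'm::{finite,wellorder}" and V
  assume E: "frob_norm E < ?d" and out: "range_finder_output \<epsilon> r (Mt + E) H U V"
  show "r \<le> rank ?N"
  proof (rule ccontr)
    assume "\<not> r \<le> rank ?N"
    moreover have "spec_norm ((Mt + E) ** H - ?N) \<le> \<epsilon> * spec_norm ((Mt + E) ** H)"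
    proof -
      have split: "(Mt + E) ** H = ?N + E ** H" by (rule matrix_add_rdistrib)
      have "spec_norm (E ** H) \<le> frob_norm E * (spec_norm H + 1)"
        by (rule order_trans[OF spec_norm_mult])
          (intro mult_mono spec_norm_le_frob_norm frob_norm_nonneg spec_norm_nonneg; simp)
      also have "\<dots> \<le> ?d * (spec_norm H + 1)" using E H by (intro mult_right_mono) auto
      also have "\<dots> = \<epsilon> * spec_norm ?N / (1 + \<epsilon>)" using H by simp
      finally have "(1 + \<epsilon>) * spec_norm (E ** H) \<le> \<epsilon> * spec_norm ?N"
        using assms(1) by (simp add: field_simps)
      moreover have "spec_norm ?N \<le> spec_norm ((Mt + E) ** H) + spec_norm (E ** H)"
        using spec_norm_diff[of "(Mt + E) ** H" "E ** H"] by (simp add: split)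
      then have "\<epsilon> * spec_norm ?N \<le> \<epsilon> * (spec_norm ((Mt + E) ** H) + spec_norm (E ** H))"
        using assms(1) by simp
      ultimately have "spec_norm (E ** H) \<le> \<epsilon> * spec_norm ((Mt + E) ** H)"
        by (simp add: algebra_simps)
      then show ?thesis by (simp add: split)
    qed
    ultimately have "numerical_rank \<epsilon> ((Mt + E) ** H) < r"
      by (intro numerical_rank_less) auto
    then show False using out by (simp add: range_finder_output_def)
  qed
qed

text \<open>Orthonormal columns make \<open>pinv U\<close> the transpose, so \<open>U ** V\<close>
  is the orthogonal projection of \<open>M\<close> onto the range of \<open>U\<close>, and the error
  is the complementary projection of \<open>M\<close>.\<close>

lemma range_finder_output_projection:
  fixes M :: "real ^ 'n::{finite,wellorder} ^ 'm::{finite,wellorder}"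
    and H :: "real ^ 'l::{finite,wellorder} ^ 'n::{finite,wellorder}"
    and U :: "real ^ 'p::{finite,wellorder} ^ 'm::{finite,wellorder}"
  assumes "range_finder_output \<epsilon> r M H U V"
  shows "M - U ** V = (mat 1 - U ** transpose U) ** M"
    "spec_norm (mat 1 - U ** transpose U) \<le> 1"
    "\<And>B :: real ^ 'l::{finite,wellorder} ^ 'm::{finite,wellorder}. col_span B \<subseteq> col_span U \<Longrightarrow> (mat 1 - U ** transpose U) ** B = 0"
proof -
  have iso: "transpose U ** U = mat 1"
    using assms leftmost_columns_isometry unfolding range_finder_output_def is_pivoted_qr_def by blast
  have "V = transpose U ** M"
    using assms pinv_isometry[OF iso] by (simp add: range_finder_output_def)
  then show "M - U ** V = (mat 1 - U ** transpose U) ** M"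
    by (simp add: matrix_diff_rdistrib matrix_mul_assoc)
  show "spec_norm (mat 1 - U ** transpose U) \<le> 1"
  proof (rule spec_norm_projection_complement)
    show "transpose (U ** transpose U) = U ** transpose U" by (simp add: matrix_transpose_mul)
    have "U ** transpose U ** (U ** transpose U) = U ** (transpose U ** U) ** transpose U"
      by (simp add: matrix_mul_assoc)
    then show "U ** transpose U ** (U ** transpose U) = U ** transpose U" by (simp add: iso)
  qed
  show "(mat 1 - U ** transpose U) ** B = 0" if "col_span B \<subseteq> col_span U" for B :: "real ^ 'l::{finite,wellorder} ^ 'm::{finite,wellorder}"
    using isometry_projection_fixes[OF iso that] by (simp add: matrix_diff_rdistrib)
qed

text \<open>The estimate is valid for \<open>E\<close> of any size and carries its second-order
  constant explicitly. The first-order terms come from the projected \<open>E\<close> and from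
  \<open>E ** H\<close> passed through the pseudo inverse.\<close>

lemma range_finder_error:
  fixes Mt :: "real ^ 'n::{finite,wellorder} ^ 'm::{finite,wellorder}"
    and H :: "real ^ 'l::{finite,wellorder} ^ 'n::{finite,wellorder}"
    and U :: "real ^ 'p::{finite,wellorder} ^ 'm::{finite,wellorder}"
  assumes out: "range_finder_output \<epsilon> r (Mt + E) H U V"
    and "rank Mt \<le> r" "r \<le> rank (Mt ** H)"
  shows "spec_norm (Mt + E - U ** V)
    \<le> spec_norm E + spec_norm (E ** H) * spec_norm (pinv (Mt ** H)) * spec_norm Mt
      + 2 * (spec_norm H)\<^sup>2 * (spec_norm (pinv (Mt ** H)))\<^sup>2 * spec_norm Mt * (frob_norm E)\<^sup>2"
proof -
  let ?N = "Mt ** H" and ?F = "E ** H"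
  let ?Z = "pinv ?N" and ?J = "mat 1 - U ** transpose U"
  note J = range_finder_output_projection[OF out]
  obtain B where B: "is_truncation r ((Mt + E) ** H) B" "col_span B \<subseteq> col_span U"
    using out unfolding range_finder_output_def by blast
  define C where "C = (Mt + E) ** H - B"
  have rkN: "rank ?N \<le> r" using assms(2) rank_mul_le_left[of Mt H] by simp
  have MH: "(Mt + E) ** H = ?N + ?F" by (rule matrix_add_rdistrib)
  have CB: "C ** transpose B = 0" and "spec_norm C \<le> spec_norm ((Mt + E) ** H - ?N)"
    unfolding C_def using truncation_remainder[OF B(1) rkN] by auto
  then have C: "spec_norm C \<le> spec_norm ?F" by (simp add: MH)
  have N: "?N = B + (C - ?F)" by (simp add: C_def MH)
  \<comment> \<open>Meant for the products of \<open>C\<close> with the transposes of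
    \<open>C\<close> and of \<open>?F\<close>.\<close>
  have sq: "spec_norm (X ** transpose Y) \<le> (spec_norm ?F)\<^sup>2"
    if "spec_norm X \<le> spec_norm ?F" "spec_norm Y \<le> spec_norm ?F" for X Y :: "real ^ 'l::{finite,wellorder} ^ 'm::{finite,wellorder}"
    unfolding power2_eq_square using that
    by (intro order_trans[OF spec_norm_mult] mult_mono spec_norm_nonneg) (auto simp: spec_norm_transpose)
  \<comment> \<open>The term \<open>transpose B\<close> is annihilated by \<open>C\<close>, so only
    quadratic terms remain.\<close>
  have "transpose ?N = transpose B + (transpose C - transpose ?F)"
    by (subst N) (simp add: transpose_def vec_eq_iff)
  then have "C ** transpose ?N = C ** transpose C - C ** transpose ?F"
    by (simp add: matrix_add_ldistrib matrix_diff_ldistrib CB)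
  then have CN: "spec_norm (C ** transpose ?N) \<le> 2 * (spec_norm ?F)\<^sup>2"
    using spec_norm_diff[of "C ** transpose C" "C ** transpose ?F"] sq[OF C C] sq[OF C order_refl] by simp
  \<comment> \<open>The pseudo inverse factors through the transpose of \<open>?N\<close>, so its product with \<open>C\<close> is of second order.\<close>
  have "?Z = transpose (?Z ** ?N) ** ?Z" by (simp add: pinv_simps)
  then have "C ** ?Z = (C ** transpose ?N) ** transpose ?Z ** ?Z"
    by (metis matrix_transpose_mul matrix_mul_assoc)
  then have "spec_norm (C ** ?Z) \<le> spec_norm (C ** transpose ?N) * spec_norm ?Z * spec_norm ?Z"
    by (metis spec_norm_mult3 spec_norm_transpose)
  also have "\<dots> \<le> 2 * (spec_norm ?F)\<^sup>2 * spec_norm ?Z * spec_norm ?Z"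
    by (intro mult_right_mono CN spec_norm_nonneg)
  finally have CZ: "spec_norm (C ** ?Z) \<le> 2 * (spec_norm ?F)\<^sup>2 * (spec_norm ?Z)\<^sup>2"
    by (simp add: power2_eq_square mult_ac)
  have F: "spec_norm ?F \<le> frob_norm E * spec_norm H"
    by (intro order_trans[OF spec_norm_mult] mult_right_mono spec_norm_le_frob_norm spec_norm_nonneg)
  have "?J ** Mt = ?J ** (?N ** ?Z ** Mt)"
    using mult_pinv_of_rank_le[of Mt H] assms(2,3) by simp
  also have "\<dots> = ?J ** ?N ** ?Z ** Mt" by (simp add: matrix_mul_assoc)
  also have "?J ** ?N = ?J ** (C - ?F)"
    by (subst N) (simp add: matrix_add_ldistrib J(3)[OF B(2)])
  also have "\<dots> ** ?Z ** Mt = ?J ** (C ** ?Z - ?F ** ?Z) ** Mt"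
    by (simp add: matrix_mul_assoc matrix_diff_ldistrib matrix_diff_rdistrib)
  finally have "spec_norm (?J ** Mt) \<le> spec_norm ?J * spec_norm (C ** ?Z - ?F ** ?Z) * spec_norm Mt"
    by (metis spec_norm_mult3)
  also have "\<dots> \<le> 1 * (spec_norm (C ** ?Z) + spec_norm ?F * spec_norm ?Z) * spec_norm Mt"
    using spec_norm_diff[of "C ** ?Z" "?F ** ?Z"] spec_norm_mult[of ?F ?Z]
    by (intro mult_right_mono mult_mono J spec_norm_nonneg) auto
  also have "\<dots> \<le> (2 * (frob_norm E * spec_norm H)\<^sup>2 * (spec_norm ?Z)\<^sup>2 + spec_norm ?F * spec_norm ?Z) * spec_norm Mt"
    using order_trans[OF CZ mult_right_mono[OF mult_left_mono[OF power_mono[OF F spec_norm_nonneg, of 2]]]]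
    by (intro mult_right_mono spec_norm_nonneg) auto
  also have "\<dots> = spec_norm ?F * spec_norm ?Z * spec_norm Mt
      + 2 * (spec_norm H)\<^sup>2 * (spec_norm ?Z)\<^sup>2 * spec_norm Mt * (frob_norm E)\<^sup>2"
    by (simp add: algebra_simps power2_eq_square)
  finally have JM: "spec_norm (?J ** Mt) \<le> \<dots>" .
  have JE: "spec_norm (?J ** E) \<le> spec_norm E"
    using mult_right_mono[OF J(2) spec_norm_nonneg[of E]] spec_norm_mult[of ?J E] by simp
  have "spec_norm (Mt + E - U ** V) \<le> spec_norm (?J ** Mt) + spec_norm (?J ** E)"
    unfolding J(1) matrix_add_ldistrib by (rule spec_norm_add)
  then show ?thesis using JM JE by linarith
qed

text \<open>Nothing is truncated here: the projection annihilates all of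
  \<open>(Mt + E) ** H\<close>, which turns \<open>Mt ** H\<close> into \<open>- (E ** H)\<close>
  exactly. Hence there is no second-order term, and \<open>H ** W\<close> is bounded as one matrix
  rather than factor by factor.\<close>

lemma range_finder_error_full_range:
  fixes Mt :: "real ^ 'n::{finite,wellorder} ^ 'm::{finite,wellorder}"
    and H :: "real ^ 'l::{finite,wellorder} ^ 'n::{finite,wellorder}"
    and U :: "real ^ 'p::{finite,wellorder} ^ 'm::{finite,wellorder}"
  assumes out: "range_finder_output \<epsilon> r (Mt + E) H U V"
    and full: "col_span U = col_span ((Mt + E) ** H)"
    and W: "Mt ** H ** W = Mt"
  shows "spec_norm (Mt + E - U ** V) \<le> (1 + spec_norm (H ** W)) * spec_norm E"
proof -
  let ?J = "mat 1 - U ** transpose U"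
  note J = range_finder_output_projection[OF out]
  have "?J ** ((Mt + E) ** H) = 0" using J(3) full by simp
  then have "?J ** (Mt ** H) = - (?J ** (E ** H))"
    by (simp add: matrix_add_ldistrib matrix_add_rdistrib add_eq_0_iff)
  then have "?J ** Mt = (0 - ?J ** (E ** H)) ** W"
    by (metis W matrix_mul_assoc diff_0)
  also have "\<dots> = - (?J ** (E ** (H ** W)))"
    by (simp add: matrix_diff_rdistrib matrix_mult_0_left matrix_mul_assoc)
  finally have "Mt + E - U ** V = ?J ** (E - E ** (H ** W))"
    unfolding J(1) by (simp add: matrix_add_ldistrib matrix_diff_ldistrib)
  then have "spec_norm (Mt + E - U ** V) \<le> spec_norm ?J * spec_norm (E - E ** (H ** W))"
    by (metis spec_norm_mult)
  also have "\<dots> \<le> 1 * (spec_norm E + spec_norm E * spec_norm (H ** W))"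
    using spec_norm_diff[of E "E ** (H ** W)"] spec_norm_mult[of E "H ** W"]
    by (intro mult_mono J spec_norm_nonneg) auto
  finally show ?thesis by (simp add: algebra_simps)
qed

text \<open>Full column rank makes \<open>A\<close> injective, so the leading \<open>A\<close>
  cancels in the first Penrose equation.\<close>

lemma pinv_left_inverse:
  fixes A :: "real ^ 'r ^ 'm"
  assumes "rank A = CARD('r)"
  shows "pinv A ** A = mat 1"
proof -
  have "A *v ((pinv A ** A) *v x) = A *v x" for x
    using pinv_simps(1)[of A] by (simp add: matrix_vector_mul_assoc matrix_mul_assoc)
  then have "(pinv A ** A) *v x = x" for x
    using assms unfolding full_rank_injective by (metis injD)
  then show ?thesis by (simp add: matrix_eq)
qed

subsection \<open>Gaussian matrices\<close>

text \<open>The combination is normal with positive variance, so it has a density and avoids any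
  given point almost surely.\<close>

lemma (in prob_space) AE_indep_normal_combination_nonzero:
  fixes X :: "'i \<Rightarrow> 'a \<Rightarrow> real" and s :: "'i \<Rightarrow> real"
  assumes fin: "finite I"
    and indep: "indep_vars (\<lambda>_. borel) X I"
    and normal: "\<And>i. i \<in> I \<Longrightarrow> distributed M lborel (X i) std_normal_density"
    and nz: "\<exists>i\<in>I. s i \<noteq> 0"
  shows "AE \<omega> in M. (\<Sum>i\<in>I. X i \<omega> * s i) \<noteq> 0"
proof -
  \<comment> \<open>Zero coefficients are dropped because they would give degenerate summands
    without a density.\<close>
  let ?J = "{i \<in> I. s i \<noteq> 0}"
  have "indep_vars (\<lambda>_. borel) (\<lambda>i \<omega>. s i * X i \<omega>) I"
    using indep by (rule indep_vars_compose2) simp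
  then have indep': "indep_vars (\<lambda>_. borel) (\<lambda>i \<omega>. s i * X i \<omega>) ?J"
    by (rule indep_vars_subset) auto
  have normal': "distributed M lborel (\<lambda>\<omega>. s i * X i \<omega>) (normal_density 0 \<bar>s i\<bar>)" if "i \<in> ?J" for i
    using normal_density_affine[of "X i" 0 1 "s i" 0] normal that by simp
  have "distributed M lborel (\<lambda>\<omega>. \<Sum>i\<in>?J. s i * X i \<omega>)
    (normal_density (\<Sum>i\<in>?J. 0) (sqrt (\<Sum>i\<in>?J. \<bar>s i\<bar>\<^sup>2)))"
    by (rule sum_indep_normal) (use fin nz indep' normal' in auto)
  then have "AE \<omega> in M. (\<Sum>i\<in>?J. s i * X i \<omega>) \<noteq> 0"
    by (subst distributed_AE2) (auto intro: AE_mp[OF AE_lborel_singleton])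
  moreover have "(\<Sum>i\<in>?J. s i * X i \<omega>) = (\<Sum>i\<in>I. X i \<omega> * s i)" for \<omega>
    using fin by (intro sum.mono_neutral_cong_left) auto
  ultimately show ?thesis by simp
qed

text \<open>In a column of \<open>S\<close> with a nonzero entry, each entry of the product is a
  nontrivial combination of one row of \<open>G\<close>; a single row suffices.\<close>

lemma gaussian_matrix_mult_nonzero:
  fixes G :: "'w \<Rightarrow> real ^ 'n ^ 'r" and S :: "real ^ 'l ^ 'n"
  assumes G: "gaussian_matrix \<Omega> G" and "S \<noteq> 0"
  shows "AE \<omega> in \<Omega>. G \<omega> ** S \<noteq> 0"
proof -
  interpret prob_space \<Omega> using G by (simp add: gaussian_matrix_def)
  obtain j k where jk: "S $ j $ k \<noteq> 0" using assms(2) by (auto simp: vec_eq_iff)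
  fix i :: 'r
  have "indep_vars (\<lambda>_. borel) (\<lambda>(i, j) \<omega>. G \<omega> $ i $ j) UNIV"
    using G by (simp add: gaussian_matrix_def)
  then have "indep_vars (\<lambda>_. borel) (\<lambda>(i, j) \<omega>. G \<omega> $ i $ j) (Pair i ` UNIV)"
    by (rule indep_vars_subset) simp
  then have "AE \<omega> in \<Omega>. (\<Sum>p\<in>Pair i ` UNIV. (case p of (i, j) \<Rightarrow> \<lambda>\<omega>. G \<omega> $ i $ j) \<omega> * S $ snd p $ k) \<noteq> 0"
    using G jk by (intro AE_indep_normal_combination_nonzero) (auto simp: gaussian_matrix_def)
  then have "AE \<omega> in \<Omega>. (\<Sum>j\<in>UNIV. G \<omega> $ i $ j * S $ j $ k) \<noteq> 0"
    by (subst (asm) sum.reindex) (auto simp: inj_on_def)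
  then show ?thesis
    by (rule AE_mp) (auto intro!: AE_I2 simp: matrix_matrix_mult_def vec_eq_iff)
qed

theorem theorem6p2:
  fixes Mt :: "real ^ 'n::{finite,wellorder} ^ 'm::{finite,wellorder}"
    and H Hr :: "real ^ 'l::{finite,wellorder} ^ 'n::{finite,wellorder}"
    and S :: "real ^ 'l::{finite,wellorder} ^ 'n::{finite,wellorder}" and D T :: "real ^ 'l::{finite,wellorder} ^ 'l::{finite,wellorder}"
    and A :: "real ^ 'r::finite ^ 'm::{finite,wellorder}"
    and \<Omega> :: "'w measure" and G :: "'w \<Rightarrow> real ^ 'n::{finite,wellorder} ^ 'r"
    and \<epsilon> :: real
  assumes tol: "0 < \<epsilon>" "\<epsilon> < 1"
    and dims: "CARD('r) \<le> CARD('l)" "CARD('l) \<le> CARD('n)"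
    and H_rank: "numerical_rank \<epsilon> H = CARD('l)"
  shows
    "(rank Mt = CARD('r) \<longrightarrow> Mt ** H \<noteq> 0 \<longrightarrow>
       (\<exists>C \<delta>. 0 < \<delta> \<and>
          (\<forall>E. frob_norm E < \<delta> \<longrightarrow>
             (\<forall>(U :: real ^ 'p::{finite,wellorder} ^ 'm::{finite,wellorder}) V.
                range_finder_output \<epsilon> CARD('r) (Mt + E) H U V \<longrightarrow>
                spec_norm (Mt + E - U ** V)
                  \<le> 2 * spec_norm E
                     + (spec_norm (E ** H)
                        + sqrt 2 * spec_norm (pinv (Mt ** H)) * frob_norm (E ** H)) * spec_norm Mt
                     + C * (frob_norm E)\<^sup>2 \<and>
                spec_norm (Mt + E - U ** V)
                  \<le> 2 * spec_norm E
                     + (1 + sqrt (2 * real CARD('r)) * spec_norm (pinv (Mt ** H)))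
                        * spec_norm Mt * spec_norm (E ** H)
                     + C * (frob_norm E)\<^sup>2))))
     \<and>
     (rank A = CARD('r) \<longrightarrow> gaussian_matrix \<Omega> G \<longrightarrow>
       is_compact_svd S D T H \<longrightarrow> is_truncation CARD('r) H Hr \<longrightarrow>
       (AE \<omega> in \<Omega>.
         \<exists>C \<delta>. 0 < \<delta> \<and>
          (\<forall>E. frob_norm E < \<delta> \<longrightarrow>
             (\<forall>(U :: real ^ 'p::{finite,wellorder} ^ 'm::{finite,wellorder}) V.
                range_finder_output \<epsilon> CARD('r) (A ** G \<omega> + E) H U V \<longrightarrow>
                (col_span U = col_span ((A ** G \<omega> + E) ** H) \<longrightarrow>
                 spec_norm (A ** G \<omega> + E - U ** V)
                  \<le> (2 + (spec_norm A * spec_norm H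
                          + sqrt (2 * real CARD('r)) * spec_norm (pinv (G \<omega> ** S))
                             * (cond_number A * cond_number Hr)) * spec_norm (G \<omega>)) * spec_norm E
                     + C * (frob_norm E)\<^sup>2) \<and>
                spec_norm (A ** G \<omega> + E - U ** V)
                  \<le> (2 + (spec_norm A * spec_norm H
                          + sqrt (2 * real CARD('r)) * spec_norm (pinv (G \<omega> ** S))
                             * (cond_number A * cond_number H)) * spec_norm (G \<omega>)) * spec_norm E
                     + C * (frob_norm E)\<^sup>2))))"
proof -
  let ?q = "sqrt (2 * real CARD('r))"
  \<comment> \<open>The error lemma has coefficient 1 where the claims have \<open>sqrt 2\<close> or
    \<open>?q\<close>, so the claims follow by monotonicity.\<close>
  have "Suc 0 \<le> CARD('r)" by (rule Suc_leI) simp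
  then have "1 \<le> real CARD('r)" by simp
  then have "1 \<le> 2 * real CARD('r)" by linarith
  then have q: "1 \<le> ?q" by simp
  show ?thesis
  proof (intro conjI impI)

    \<comment> \<open>The bounds for a fixed matrix of rank r\<close>
    assume rk: "rank Mt = CARD('r)" and nz: "Mt ** H \<noteq> 0"
    let ?Z = "pinv (Mt ** H)" and ?r = "real CARD('r)"
    let ?C = "2 * (spec_norm H)\<^sup>2 * (spec_norm ?Z)\<^sup>2 * spec_norm Mt"
    \<comment> \<open>Within this radius a run without FAILURE certifies that \<open>Mt ** H\<close>
      has the rank that \<open>range_finder_error\<close> asks for.\<close>
    obtain \<delta> where \<delta>: "0 < \<delta>"
      "\<And>E (U :: real ^ 'p::{finite,wellorder} ^ 'm::{finite,wellorder}) V. frob_norm E < \<delta> \<Longrightarrow>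
        range_finder_output \<epsilon> CARD('r) (Mt + E) H U V \<Longrightarrow> CARD('r) \<le> rank (Mt ** H)"
      using range_finder_output_rank[OF tol(1) nz] by metis
    have "spec_norm (Mt + E - U ** V) \<le> 2 * spec_norm E
             + (spec_norm (E ** H) + sqrt 2 * spec_norm ?Z * frob_norm (E ** H)) * spec_norm Mt
             + ?C * (frob_norm E)\<^sup>2 \<and>
          spec_norm (Mt + E - U ** V) \<le> 2 * spec_norm E
             + (1 + sqrt (2 * ?r) * spec_norm ?Z) * spec_norm Mt * spec_norm (E ** H)
             + ?C * (frob_norm E)\<^sup>2"
      if E: "frob_norm E < \<delta>" and out: "range_finder_output \<epsilon> CARD('r) (Mt + E) H U V"
      for E and U :: "real ^ 'p::{finite,wellorder} ^ 'm::{finite,wellorder}" and V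
    proof -
      note err = range_finder_error[OF out eq_imp_le[OF rk] \<delta>(2)[OF E out]]
      note nn = spec_norm_nonneg[of ?Z] spec_norm_nonneg[of Mt] spec_norm_nonneg[of "E ** H"] spec_norm_nonneg[of E]
      have "1 * spec_norm ?Z * spec_norm (E ** H) \<le> sqrt 2 * spec_norm ?Z * frob_norm (E ** H)"
        using nn by (intro mult_mono spec_norm_le_frob_norm) (auto simp: frob_norm_nonneg)
      then have 1: "spec_norm (E ** H) * spec_norm ?Z * spec_norm Mt
        \<le> (spec_norm (E ** H) + sqrt 2 * spec_norm ?Z * frob_norm (E ** H)) * spec_norm Mt"
        using nn by (intro mult_right_mono) (auto simp: mult_ac)
      have "1 * spec_norm ?Z \<le> sqrt (2 * ?r) * spec_norm ?Z"
        using nn q by (intro mult_right_mono)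
      then have "spec_norm ?Z * spec_norm Mt * spec_norm (E ** H)
        \<le> (1 + sqrt (2 * ?r) * spec_norm ?Z) * spec_norm Mt * spec_norm (E ** H)"
        using nn by (intro mult_right_mono) auto
      then have 2: "spec_norm (E ** H) * spec_norm ?Z * spec_norm Mt
        \<le> (1 + sqrt (2 * ?r) * spec_norm ?Z) * spec_norm Mt * spec_norm (E ** H)"
        by (simp add: mult_ac)
      show ?thesis using err 1 2 nn by linarith
    qed
    then show "\<exists>C \<delta>. 0 < \<delta> \<and>
            (\<forall>E. frob_norm E < \<delta> \<longrightarrow>
               (\<forall>(U :: real ^ 'p::{finite,wellorder} ^ 'm::{finite,wellorder}) V.
                  range_finder_output \<epsilon> CARD('r) (Mt + E) H U V \<longrightarrow>
                  spec_norm (Mt + E - U ** V)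
                    \<le> 2 * spec_norm E
                       + (spec_norm (E ** H)
                          + sqrt 2 * spec_norm (pinv (Mt ** H)) * frob_norm (E ** H)) * spec_norm Mt
                       + C * (frob_norm E)\<^sup>2 \<and>
                  spec_norm (Mt + E - U ** V)
                    \<le> 2 * spec_norm E
                       + (1 + sqrt (2 * real CARD('r)) * spec_norm (pinv (Mt ** H)))
                          * spec_norm Mt * spec_norm (E ** H)
                       + C * (frob_norm E)\<^sup>2))"
      using \<delta>(1) by blast
  next

    \<comment> \<open>The bounds for a factor-Gaussian matrix\<close>
    assume rkA: "rank A = CARD('r)" and G: "gaussian_matrix \<Omega> G"
      and svd: "is_compact_svd S D T H" and tr: "is_truncation CARD('r) H Hr"
    note svd' = svd[unfolded is_compact_svd_def]
    have r0: "0 < CARD('r)" by simp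
    have A0: "A \<noteq> 0" using rkA r0 rank_eq_0[of A] by simp
    have H0: "H \<noteq> 0" using svd' rank_eq_0[of H] by (metis zero_less_card_finite less_irrefl)
    have S0: "S \<noteq> 0" using svd' H0 by (metis matrix_mult_0_left)
    have Hr0: "Hr \<noteq> 0" using truncation_nonzero[OF tr r0 H0] .
    obtain W where W: "D ** transpose T ** W = mat 1"
      using compact_svd_core_inverse[OF svd] .
    \<comment> \<open>This puts the columns of \<open>S\<close> into the range of \<open>H\<close>,
      on which \<open>H ** pinv H\<close> is the identity.\<close>
    have HW: "H ** W = S" using svd' W by (metis matrix_mul_assoc matrix_mul_rid)
    have HHS: "H ** pinv H ** S = S"
      using pinv_simps(1)[of H] by (metis HW matrix_mul_assoc)
    have AA: "pinv A ** A = mat 1" using rkA by (rule pinv_left_inverse)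
    have nS: "spec_norm S \<le> 1" using svd' by (intro spec_norm_isometry) simp
    have \<kappa>A: "1 \<le> cond_number A" and \<kappa>H: "1 \<le> cond_number H" and \<kappa>Hr: "1 \<le> cond_number Hr"
      using A0 H0 Hr0 by (auto intro: cond_number_ge_1)

    show "AE \<omega> in \<Omega>.
           \<exists>C \<delta>. 0 < \<delta> \<and>
            (\<forall>E. frob_norm E < \<delta> \<longrightarrow>
               (\<forall>(U :: real ^ 'p::{finite,wellorder} ^ 'm::{finite,wellorder}) V.
                  range_finder_output \<epsilon> CARD('r) (A ** G \<omega> + E) H U V \<longrightarrow>
                  (col_span U = col_span ((A ** G \<omega> + E) ** H) \<longrightarrow>
                   spec_norm (A ** G \<omega> + E - U ** V)
                    \<le> (2 + (spec_norm A * spec_norm H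
                            + sqrt (2 * real CARD('r)) * spec_norm (pinv (G \<omega> ** S))
                               * (cond_number A * cond_number Hr)) * spec_norm (G \<omega>)) * spec_norm E
                       + C * (frob_norm E)\<^sup>2) \<and>
                  spec_norm (A ** G \<omega> + E - U ** V)
                    \<le> (2 + (spec_norm A * spec_norm H
                            + sqrt (2 * real CARD('r)) * spec_norm (pinv (G \<omega> ** S))
                               * (cond_number A * cond_number H)) * spec_norm (G \<omega>)) * spec_norm E
                       + C * (frob_norm E)\<^sup>2))"
      using gaussian_matrix_mult_nonzero[OF G S0]
    proof (rule AE_mp, intro AE_I2 impI)
      fix \<omega>
      assume K0: "G \<omega> ** S \<noteq> 0"
      let ?G = "G \<omega>" and ?K = "G \<omega> ** S"
      \<comment> \<open>\<open>pinv H ** S\<close> is a right inverse of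
        \<open>D ** transpose T\<close>, so \<open>?Z\<close> reverses the three factors in
        \<open>NK\<close>. Choosing it instead of \<open>W\<close> lets the norm of
        \<open>pinv H\<close> appear, as the condition number requires.\<close>
      let ?N = "A ** ?G ** H" and ?Z = "pinv H ** S ** pinv ?K ** pinv A"
      have NK: "?N = A ** ?K ** (D ** transpose T)"
        using svd' by (simp add: matrix_mul_assoc)
      \<comment> \<open>\<open>pinv A\<close> on the left and \<open>W\<close> on the right recover
        \<open>?K\<close> from \<open>?N\<close>.\<close>
      have N0: "?N \<noteq> 0"
      proof
        assume "?N = 0"
        have "?K = pinv A ** A ** ?K ** (D ** transpose T ** W)" by (simp add: AA W)
        also have "\<dots> = pinv A ** ?N ** W" by (simp add: NK matrix_mul_assoc)
        finally show False using \<open>?N = 0\<close> K0 by (simp add: matrix_mult_0_left matrix_mult_0_right)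
      qed
      have HZ: "H ** (?Z ** (A ** ?G)) = S ** pinv ?K ** ?G"
      proof -
        have "H ** (?Z ** (A ** ?G)) = (H ** pinv H ** S) ** pinv ?K ** (pinv A ** A) ** ?G"
          by (simp add: matrix_mul_assoc)
        then show ?thesis by (simp add: HHS AA)
      qed
      have NZN: "?N ** ?Z ** ?N = ?N"
      proof -
        have "?N ** ?Z ** ?N = A ** ?G ** (H ** (?Z ** (A ** ?G))) ** H" by (simp add: matrix_mul_assoc)
        also have "\<dots> = A ** (?K ** pinv ?K ** ?G) ** H" unfolding HZ by (simp add: matrix_mul_assoc)
        also have "\<dots> = A ** (?K ** pinv ?K ** ?K) ** (D ** transpose T)"
          using svd' by (simp add: matrix_mul_assoc)
        also have "\<dots> = ?N" by (simp add: pinv_simps NK)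
        finally show ?thesis .
      qed
      let ?k = "spec_norm (pinv ?K)" and ?g = "spec_norm ?G"
      note nn = spec_norm_nonneg[of "pinv ?K"] spec_norm_nonneg[of ?G] spec_norm_nonneg[of A]
        spec_norm_nonneg[of H] spec_norm_nonneg[of "pinv A"] spec_norm_nonneg[of "pinv H"]
      have "spec_norm ?Z \<le> spec_norm (pinv H ** S) * ?k * spec_norm (pinv A)"
        by (rule spec_norm_mult3)
      also have "\<dots> \<le> spec_norm (pinv H) * ?k * spec_norm (pinv A)"
        using spec_norm_mult[of "pinv H" S] mult_left_mono[OF nS nn(6)] nn by (intro mult_right_mono) auto
      finally have nZ: "spec_norm (pinv ?N) \<le> spec_norm (pinv H) * ?k * spec_norm (pinv A)"
        using spec_norm_pinv_le[OF NZN] by simp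
      let ?C = "2 * (spec_norm H)\<^sup>2 * (spec_norm (pinv ?N))\<^sup>2 * spec_norm (A ** ?G)"
      have C0: "0 \<le> ?C" by (simp add: spec_norm_nonneg)
      obtain \<delta> where \<delta>: "0 < \<delta>"
        "\<And>E (U :: real ^ 'p::{finite,wellorder} ^ 'm::{finite,wellorder}) V. frob_norm E < \<delta> \<Longrightarrow>
          range_finder_output \<epsilon> CARD('r) (A ** ?G + E) H U V \<Longrightarrow> CARD('r) \<le> rank ?N"
        using range_finder_output_rank[OF tol(1) N0] by metis
      have rkAG: "rank (A ** ?G) \<le> CARD('r)" using rank_mul_le_left[of A ?G] rkA by simp
      let ?bound = "\<lambda>\<kappa> E. (2 + (spec_norm A * spec_norm H + ?q * ?k * \<kappa>) * ?g) * spec_norm E"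
      have bound: "(1 + \<kappa> * ?k * ?g) * spec_norm E \<le> ?bound \<kappa> E" if "0 \<le> \<kappa>" for \<kappa> and E :: "real ^ 'n::{finite,wellorder} ^ 'm::{finite,wellorder}"
      proof -
        have "1 * ?k * \<kappa> \<le> ?q * ?k * \<kappa>"
          using q nn that by (intro mult_right_mono) auto
        moreover have "0 \<le> spec_norm A * spec_norm H" using nn by simp
        ultimately have "\<kappa> * ?k \<le> spec_norm A * spec_norm H + ?q * ?k * \<kappa>"
          by (simp add: mult_ac)
        then have "\<kappa> * ?k * ?g \<le> (spec_norm A * spec_norm H + ?q * ?k * \<kappa>) * ?g"
          using nn by (intro mult_right_mono)
        then show ?thesis by (intro mult_right_mono spec_norm_nonneg) simp
      qed
      have "(col_span U = col_span ((A ** ?G + E) ** H) \<longrightarrow>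
              spec_norm (A ** ?G + E - U ** V) \<le> ?bound (cond_number A * cond_number Hr) E + ?C * (frob_norm E)\<^sup>2) \<and>
            spec_norm (A ** ?G + E - U ** V) \<le> ?bound (cond_number A * cond_number H) E + ?C * (frob_norm E)\<^sup>2"
        if E: "frob_norm E < \<delta>" and out: "range_finder_output \<epsilon> CARD('r) (A ** ?G + E) H U V"
        for E and U :: "real ^ 'p::{finite,wellorder} ^ 'm::{finite,wellorder}" and V
      proof (intro conjI impI)
        note rkN = \<delta>(2)[OF E out]
        assume full: "col_span U = col_span ((A ** ?G + E) ** H)"
        \<comment> \<open>Inserting \<open>?N ** pinv ?N\<close>, which fixes
          \<open>A ** ?G\<close>, makes \<open>NZN\<close> applicable. So
          \<open>?Z ** (A ** ?G)\<close> serves as the \<open>W\<close> of the full-range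
          lemma.\<close>
        have "?N ** (?Z ** (A ** ?G)) = ?N ** ?Z ** (?N ** pinv ?N ** (A ** ?G))"
          using mult_pinv_of_rank_le[of "A ** ?G" H] rkN rkAG by (simp add: matrix_mul_assoc)
        also have "\<dots> = ?N ** ?Z ** ?N ** pinv ?N ** (A ** ?G)" by (simp add: matrix_mul_assoc)
        also have "\<dots> = A ** ?G"
          unfolding NZN using mult_pinv_of_rank_le[of "A ** ?G" H] rkN rkAG by simp
        finally have "spec_norm (A ** ?G + E - U ** V) \<le> (1 + spec_norm (H ** (?Z ** (A ** ?G)))) * spec_norm E"
          by (rule range_finder_error_full_range[OF out full])
        also have "\<dots> \<le> (1 + cond_number A * cond_number Hr * ?k * ?g) * spec_norm E"
        proof -
          have "spec_norm (H ** (?Z ** (A ** ?G))) \<le> spec_norm S * ?k * ?g"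
            unfolding HZ by (rule spec_norm_mult3)
          \<comment> \<open>\<open>S\<close> has norm at most one, while both condition numbers are
            at least one.\<close>
          also have "\<dots> \<le> (cond_number A * cond_number Hr) * ?k * ?g"
            using nS mult_mono[OF \<kappa>A \<kappa>Hr] \<kappa>A nn by (intro mult_right_mono) auto
          finally show ?thesis by (intro mult_right_mono spec_norm_nonneg) simp
        qed
        also have "\<dots> \<le> ?bound (cond_number A * cond_number Hr) E"
          using \<kappa>A \<kappa>Hr by (intro bound) simp
        finally show "spec_norm (A ** ?G + E - U ** V) \<le> ?bound (cond_number A * cond_number Hr) E + ?C * (frob_norm E)\<^sup>2"
          using mult_nonneg_nonneg[OF C0 zero_le_power2, of "frob_norm E"] by linarith
      next
        \<comment> \<open>Pairing the norms of \<open>H\<close> and \<open>pinv H\<close>, and of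
          \<open>A\<close> and \<open>pinv A\<close>, produces the two condition numbers.\<close>
        have "spec_norm (E ** H) * spec_norm (pinv ?N) * spec_norm (A ** ?G)
          \<le> (spec_norm E * spec_norm H) * (spec_norm (pinv H) * ?k * spec_norm (pinv A)) * (spec_norm A * ?g)"
          by (intro mult_mono spec_norm_mult nZ mult_nonneg_nonneg spec_norm_nonneg)
        also have "\<dots> = (cond_number A * cond_number H * ?k * ?g) * spec_norm E"
          by (simp add: cond_number_def mult_ac)
        finally have "spec_norm (A ** ?G + E - U ** V)
            \<le> (1 + cond_number A * cond_number H * ?k * ?g) * spec_norm E + ?C * (frob_norm E)\<^sup>2"
          using range_finder_error[OF out rkAG \<delta>(2)[OF E out]] by (simp add: distrib_right)
        also have "\<dots> \<le> ?bound (cond_number A * cond_number H) E + ?C * (frob_norm E)\<^sup>2"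
          using \<kappa>A \<kappa>H by (intro add_right_mono bound) simp
        finally show "spec_norm (A ** ?G + E - U ** V) \<le> ?bound (cond_number A * cond_number H) E + ?C * (frob_norm E)\<^sup>2" .
      qed
      then show "\<exists>C \<delta>. 0 < \<delta> \<and>
            (\<forall>E. frob_norm E < \<delta> \<longrightarrow>
               (\<forall>(U :: real ^ 'p::{finite,wellorder} ^ 'm::{finite,wellorder}) V.
                  range_finder_output \<epsilon> CARD('r) (A ** G \<omega> + E) H U V \<longrightarrow>
                  (col_span U = col_span ((A ** G \<omega> + E) ** H) \<longrightarrow>
                   spec_norm (A ** G \<omega> + E - U ** V)
                    \<le> ?bound (cond_number A * cond_number Hr) E
                       + C * (frob_norm E)\<^sup>2) \<and>
                  spec_norm (A ** G \<omega> + E - U ** V)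
                    \<le> ?bound (cond_number A * cond_number H) E
                       + C * (frob_norm E)\<^sup>2))"
        using \<delta>(1) by blast
    qed
  qed
qed

end
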